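(* There exists an algorithm that correctly computes an optimal solution (a cut system of cost at most $B$ minimizing the risk) for any instance of Windy Firebreak Location on a tree $T=(V,E)$ with all spread probabilities 1, edge costs $\kappa(e)\in\mathbb N$ for all $e\in E$, arbitrary vertex values $\varphi$, ignition probabilities $\pi_i(v)\in\{0,1\}$, and budget $B$. Its running time is polynomial in $|V|$ if $B=O(\mathrm{Poly}(|V|))$ or if $\kappa(e)=O(\mathrm{Poly}(|V|))$ for all $e$.
   Context: Windy Firebreak Location (optimization version) on an undirected graph: a cut system is a set $H\subseteq E$ of edges, $T_H$ is the graph with these edges removed, its cost is $\kappa(H)=\sum_{e\in H}\kappa(e)$, and the risk is $\rho(T_H)=\sum_{x\in V}\varphi(x)\left(1-\prod_{t\in U_{x,H}}(1-\pi_i(t))\right)$, where $U_{x,H}$ is the set of vertices in the connected component of $x$ in $T_H$. The goal is to find a cut system with $\kappa(H)\le B$ minimizing the risk. *)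

theory Defs
  imports Complex_Main
begin

section \<open>Undirected graphs and the risk of a cut system\<close>

definition adj :: "'a set set \<Rightarrow> ('a \<times> 'a) set" where
  "adj E = {(u, v). {u, v} \<in> E}"

definition component :: "'a set \<Rightarrow> 'a set set \<Rightarrow> 'a \<Rightarrow> 'a set" where
  "component V E x = {y \<in> V. (x, y) \<in> (adj E)\<^sup>*}"

definition simple_graph :: "'a set \<Rightarrow> 'a set set \<Rightarrow> bool" where
  "simple_graph V E \<longleftrightarrow> finite V \<and> (\<forall>e\<in>E. e \<subseteq> V \<and> card e = 2)"

definition connected_graph :: "'a set \<Rightarrow> 'a set set \<Rightarrow> bool" where
  "connected_graph V E \<longleftrightarrow> V \<noteq> {} \<and> (\<forall>x\<in>V. component V E x = V)"

definition is_cycle :: "'a set set \<Rightarrow> 'a list \<Rightarrow> bool" where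
  "is_cycle E p \<longleftrightarrow> length p \<ge> 3 \<and> distinct p \<and>
     (\<forall>i<length p. {p ! i, p ! (Suc i mod length p)} \<in> E)"

definition tree_graph :: "'a set \<Rightarrow> 'a set set \<Rightarrow> bool" where
  "tree_graph V E \<longleftrightarrow> simple_graph V E \<and> connected_graph V E \<and> \<not> (\<exists>p. is_cycle E p)"

definition risk ::
  "'a set \<Rightarrow> 'a set set \<Rightarrow> ('a \<Rightarrow> real) \<Rightarrow> ('a \<Rightarrow> real) \<Rightarrow> 'a set set \<Rightarrow> real" where
  "risk V E \<phi> \<pi> H =
     (\<Sum>x\<in>V. \<phi> x * (1 - (\<Prod>t\<in>component V (E - H) x. 1 - \<pi> t)))"


section \<open>Instances and optimal solutions\<close>

text \<open>
  The vertex set is \<open>{..<nverts I}\<close>, since a program has to receive vertices as numbers.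
  All spread probabilities are 1: this is built into \<^const>\<open>risk\<close>, where a fire reaches
  precisely the component of its origin.
\<close>

record wfl =
  nverts :: nat
  edges :: "nat set set"
  cost :: "nat set \<Rightarrow> nat"
  vertex_value :: "nat \<Rightarrow> real"
  ignition :: "nat \<Rightarrow> real"
  budget :: real

abbreviation verts :: "wfl \<Rightarrow> nat set" where
  "verts I \<equiv> {..<nverts I}"

definition wfl_tree :: "wfl \<Rightarrow> bool" where
  "wfl_tree I \<longleftrightarrow> tree_graph (verts I) (edges I) \<and>
     (\<forall>v\<in>verts I. ignition I v \<in> {0, 1}) \<and> budget I \<ge> 0"

definition feasible :: "wfl \<Rightarrow> nat set set \<Rightarrow> bool" where
  "feasible I H \<longleftrightarrow> H \<subseteq> edges I \<and> real (\<Sum>e\<in>H. cost I e) \<le> budget I"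

definition wfl_risk :: "wfl \<Rightarrow> nat set set \<Rightarrow> real" where
  "wfl_risk I H = risk (verts I) (edges I) (vertex_value I) (ignition I) H"

definition optimal :: "wfl \<Rightarrow> nat set set \<Rightarrow> bool" where
  "optimal I H \<longleftrightarrow> feasible I H \<and> (\<forall>H'. feasible I H' \<longrightarrow> wfl_risk I H \<le> wfl_risk I H')"


section \<open>Model of computation: structured unit-cost random access machine\<close>

text \<open>
  The memory consists of named, zero-initialised arrays, holding natural numbers in one bank and
  reals in the other; index expressions may themselves read memory (indirect addressing).
  There is no multiplication, division or rounding, no transfer from reals to naturals
  except through comparisons, and real constants in programs are integers. Hence stored
  numbers grow by only a constant number of bits per step, and neither bank can be abused to do
  superpolynomial work, or to hold non-uniform advice, at unit cost. Every assignment and every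
  test costs one step; the expressions in them have a size fixed by the program.
\<close>

type_synonym vname = string
type_synonym state = "(vname \<Rightarrow> nat \<Rightarrow> nat) \<times> (vname \<Rightarrow> nat \<Rightarrow> real)"

datatype nexp =
    NConst nat
  | NLoad vname nexp
  | NAdd nexp nexp
  | NSub nexp nexp

datatype rexp =
    RConst int
  | RLoad vname nexp
  | RAdd rexp rexp
  | RSub rexp rexp

datatype bexp =
    NLe nexp nexp
  | RLe rexp rexp
  | BNot bexp
  | BAnd bexp bexp

datatype com =
    Skip
  | NStore vname nexp nexp
  | RStore vname nexp rexp
  | Seq com com
  | Cond bexp com com
  | While bexp com

fun nval :: "nexp \<Rightarrow> state \<Rightarrow> nat" where
  "nval (NConst k) s = k"
| "nval (NLoad a i) s = fst s a (nval i s)"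
| "nval (NAdd e f) s = nval e s + nval f s"
| "nval (NSub e f) s = nval e s - nval f s"

fun rval :: "rexp \<Rightarrow> state \<Rightarrow> real" where
  "rval (RConst k) s = real_of_int k"
| "rval (RLoad a i) s = snd s a (nval i s)"
| "rval (RAdd e f) s = rval e s + rval f s"
| "rval (RSub e f) s = rval e s - rval f s"

fun bval :: "bexp \<Rightarrow> state \<Rightarrow> bool" where
  "bval (NLe e f) s \<longleftrightarrow> nval e s \<le> nval f s"
| "bval (RLe e f) s \<longleftrightarrow> rval e s \<le> rval f s"
| "bval (BNot b) s \<longleftrightarrow> \<not> bval b s"
| "bval (BAnd b c) s \<longleftrightarrow> bval b s \<and> bval c s"

definition store :: "vname \<Rightarrow> nat \<Rightarrow> 'v \<Rightarrow> (vname \<Rightarrow> nat \<Rightarrow> 'v) \<Rightarrow> vname \<Rightarrow> nat \<Rightarrow> 'v" where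
  "store a i x M = M(a := (M a)(i := x))"

text \<open>\<open>exec c s t s'\<close>: started in \<open>s\<close>, \<open>c\<close> halts in \<open>s'\<close> after \<open>t\<close> steps.\<close>

inductive exec :: "com \<Rightarrow> state \<Rightarrow> nat \<Rightarrow> state \<Rightarrow> bool" where
  Skip: "exec Skip s 1 s"
| NStore: "exec (NStore a i e) s 1 (store a (nval i s) (nval e s) (fst s), snd s)"
| RStore: "exec (RStore a i e) s 1 (fst s, store a (nval i s) (rval e s) (snd s))"
| Seq: "exec c s t s' \<Longrightarrow> exec d s' t' s'' \<Longrightarrow> exec (Seq c d) s (t + t') s''"
| CondTrue: "bval b s \<Longrightarrow> exec c s t s' \<Longrightarrow> exec (Cond b c d) s (t + 1) s'"
| CondFalse: "\<not> bval b s \<Longrightarrow> exec d s t s' \<Longrightarrow> exec (Cond b c d) s (t + 1) s'"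
| WhileFalse: "\<not> bval b s \<Longrightarrow> exec (While b c) s 1 s"
| WhileTrue: "bval b s \<Longrightarrow> exec c s t s' \<Longrightarrow> exec (While b c) s' t' s'' \<Longrightarrow>
    exec (While b c) s (t + t' + 1) s''"


section \<open>Input and output\<close>

text \<open>
  The edges are presented in an arbitrary order, and the two ends of each edge in an arbitrary
  order. The \<open>i\<close>-th edge is in the output set iff entry \<open>i\<close> of the array \<open>''cut''\<close> is nonzero.
\<close>

definition edge_listing :: "wfl \<Rightarrow> (nat \<times> nat) list \<Rightarrow> bool" where
  "edge_listing I es \<longleftrightarrow> (let ls = map (\<lambda>(u, v). {u, v}) es in distinct ls \<and> set ls = edges I)"

definition array_of :: "'v::zero list \<Rightarrow> nat \<Rightarrow> 'v" where
  "array_of xs i = (if i < length xs then xs ! i else 0)"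

definition encode :: "wfl \<Rightarrow> (nat \<times> nat) list \<Rightarrow> state" where
  "encode I es =
     ((\<lambda>_ _. 0)(
        ''n'' := array_of [nverts I],
        ''m'' := array_of [length es],
        ''src'' := array_of (map fst es),
        ''dst'' := array_of (map snd es),
        ''cost'' := array_of (map (\<lambda>(u, v). cost I {u, v}) es)),
      (\<lambda>_ _. 0)(
        ''value'' := array_of (map (vertex_value I) [0..<nverts I]),
        ''ignition'' := array_of (map (ignition I) [0..<nverts I]),
        ''budget'' := array_of [budget I]))"

definition cut_set :: "(nat \<times> nat) list \<Rightarrow> state \<Rightarrow> nat set set" where
  "cut_set es s = {{fst (es ! i), snd (es ! i)} | i. i < length es \<and> fst s ''cut'' i \<noteq> 0}"


section \<open>Correctness and running time\<close>

definition solves_wfl_tree :: "com \<Rightarrow> bool" where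
  "solves_wfl_tree P \<longleftrightarrow>
     (\<forall>I es. wfl_tree I \<longrightarrow> edge_listing I es \<longrightarrow>
        (\<exists>t s. exec P (encode I es) t s \<and> optimal I (cut_set es s)))"

text \<open>
  A set of pairs \<open>(n, x)\<close>, read as a quantity \<open>x\<close> attained at size \<open>n\<close>, is of order \<open>Poly(n)\<close>.
\<close>

definition poly_bounded :: "(nat \<times> real) set \<Rightarrow> bool" where
  "poly_bounded S \<longleftrightarrow> (\<exists>c k :: nat. \<forall>(n, x)\<in>S. x \<le> real c * real n ^ k)"

definition budgets :: "wfl set \<Rightarrow> (nat \<times> real) set" where
  "budgets F = {(nverts I, budget I) | I. I \<in> F}"

definition edge_costs :: "wfl set \<Rightarrow> (nat \<times> real) set" where
  "edge_costs F = {(nverts I, real (cost I e)) | I e. I \<in> F \<and> e \<in> edges I}"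

definition running_times :: "com \<Rightarrow> wfl set \<Rightarrow> (nat \<times> real) set" where
  "running_times P F = {(nverts I, real t) | I es t s.
     I \<in> F \<and> edge_listing I es \<and> exec P (encode I es) t s}"

end

theory Submission
  imports Defs
begin

text \<open>The machine model shapes the construction. It has no multiplication, no rounding and no
  conversion of reals to naturals, and a set cannot be copied in one step. So \<open>W\<close> is
  counted up beside a real counter, powers of two come from doubling, and sets of cut edges travel
  as numbers, for which the union of the two sides is one addition; merged subtrees share no edge.
  Tables are never overwritten: each merge fills a fresh block above all earlier ones, so reads and
  writes cannot interfere, and the zeros found there serve as an empty table. Running time is
  handled without following individual steps: every loop makes at most
  \<open>Z = n + m + W + 2\<close> rounds, and the time of a fixed program is then polynomial in
  \<open>Z\<close>. The two hypotheses meet in \<open>W\<close>, which is at most the budget and at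
  most the number of edges times the largest cost. That the grown list of edges is complete follows
  from acyclicity.\<close>

text \<open>
  The program is a dynamic programme over the budget. Cutting costs at most
  \<open>W = min (\<Sum>\<kappa>(e)) \<lfloor>B\<rfloor>\<close>, which is polynomially bounded under either hypothesis. Growing a
  visited set from vertex 0 lists the edges as (parent, child) pairs; run backwards, this list merges
  the finished subtree of a child into the partial subtree of its parent. Since vertex values may be
  negative, a partial solution does not only record whether the component of the root already contains
  an ignition: it also promises whether that component will burn in the end, and its risk is
  evaluated under this promise. A promise of burning that is not yet fulfilled must be fulfilled by
  a later merge along a kept edge, while cutting an edge requires the promise of the child to be true.
  For each root, promise and budget \<open>w \<le> W\<close> the table stores the least risk together with a
  solution attaining it, as the number \<open>\<Sum>2\<^sup>i\<close> over the indices \<open>i\<close> of the cut edges;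
  binary decoding of one such number gives the output.
\<close>

section \<open>Total correctness and running time of programs\<close>

fun nat_writes :: "com \<Rightarrow> vname set" where
  "nat_writes Skip = {}"
| "nat_writes (NStore a i e) = {a}"
| "nat_writes (RStore a i e) = {}"
| "nat_writes (Seq c d) = nat_writes c \<union> nat_writes d"
| "nat_writes (Cond b c d) = nat_writes c \<union> nat_writes d"
| "nat_writes (While b c) = nat_writes c"

fun real_writes :: "com \<Rightarrow> vname set" where
  "real_writes Skip = {}"
| "real_writes (NStore a i e) = {}"
| "real_writes (RStore a i e) = {a}"
| "real_writes (Seq c d) = real_writes c \<union> real_writes d"
| "real_writes (Cond b c d) = real_writes c \<union> real_writes d"
| "real_writes (While b c) = real_writes c"

text \<open>Arrays are tracked by name as a whole, so the syntax of a program fragment decides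
  whether a value survives it. Loop invariants then mention only what the loop changes.\<close>

definition frame :: "com \<Rightarrow> state \<Rightarrow> state \<Rightarrow> bool" where
  "frame c s s' \<longleftrightarrow> (\<forall>a. a \<notin> nat_writes c \<longrightarrow> fst s' a = fst s a) \<and> (\<forall>a. a \<notin> real_writes c \<longrightarrow> snd s' a = snd s a)"

lemma frame_nat: "frame c s s' \<Longrightarrow> a \<notin> nat_writes c \<Longrightarrow> fst s' a = fst s a"
  and frame_real: "frame c s s' \<Longrightarrow> a \<notin> real_writes c \<Longrightarrow> snd s' a = snd s a"
  by (auto simp: frame_def)

lemma frame_refl: "frame c s s"
  by (simp add: frame_def)

lemma frame_trans: "frame c s s' \<Longrightarrow> frame c s' s'' \<Longrightarrow> frame c s s''"
  by (simp add: frame_def)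

lemma frame_mono: "frame c s s' \<Longrightarrow> nat_writes c \<subseteq> nat_writes d \<Longrightarrow> real_writes c \<subseteq> real_writes d \<Longrightarrow> frame d s s'"
  unfolding frame_def by blast

lemma exec_frame: "exec c s t s' \<Longrightarrow> frame c s s'"
  by (induction rule: exec.induct) (auto simp: frame_def store_def)

inductive_cases exec_SkipE: "exec Skip s t s'"
inductive_cases exec_NStoreE: "exec (NStore a i e) s t s'"
inductive_cases exec_RStoreE: "exec (RStore a i e) s t s'"
inductive_cases exec_SeqE: "exec (Seq c d) s t s'"
inductive_cases exec_CondE: "exec (Cond b c d) s t s'"
inductive_cases exec_WhileE: "exec (While b c) s t s'"

text \<open>\<open>running_times\<close> ranges over all executions, whereas the construction
  exhibits one; determinism carries its bound to every other.\<close>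

lemma exec_deterministic:
  "exec c s t s' \<Longrightarrow> exec c s t2 s2 \<Longrightarrow> t2 = t \<and> s2 = s'"
proof (induction arbitrary: t2 s2 rule: exec.induct)
  case (Skip s)
  then show ?case by (rule exec_SkipE) simp
next
  case (NStore a i e s)
  then show ?case by (rule exec_NStoreE) simp
next
  case (RStore a i e s)
  then show ?case by (rule exec_RStoreE) simp
next
  case (Seq c s t s' d t' s'')
  show ?case by (rule exec_SeqE[OF Seq.prems]) (use Seq.IH in blast)
next
  case (CondTrue b s c t s' d)
  from CondTrue.prems show ?case
  proof (rule exec_CondE)
    fix u assume "t2 = Suc u" "exec c s u s2"
    then show ?thesis using CondTrue.IH[of u s2] by simp
  qed (use CondTrue.hyps in simp)
next
  case (CondFalse b s d t s' c)
  from CondFalse.prems show ?case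
  proof (rule exec_CondE)
    fix u assume "t2 = Suc u" "exec d s u s2"
    then show ?thesis using CondFalse.IH[of u s2] by simp
  qed (use CondFalse.hyps in simp)
next
  case (WhileFalse b s c)
  from WhileFalse.prems show ?case by (rule exec_WhileE) (use WhileFalse.hyps in simp_all)
next
  case (WhileTrue b s c t s' t' s'')
  from WhileTrue.prems show ?case
  proof (rule exec_WhileE)
    fix u u' r assume h: "t2 = Suc (u + u')" "exec c s u r" "exec (While b c) r u' s2"
    then show ?thesis using WhileTrue.IH(1)[OF h(2)] WhileTrue.IH(2)[of u' s2] by simp
  qed (use WhileTrue.hyps in simp)
qed

text \<open>A bound on the running time when no loop makes more than \<open>Z\<close> iterations.\<close>

fun time_bound :: "nat \<Rightarrow> com \<Rightarrow> nat" where
  "time_bound Z Skip = 1"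
| "time_bound Z (NStore a i e) = 1"
| "time_bound Z (RStore a i e) = 1"
| "time_bound Z (Seq c d) = time_bound Z c + time_bound Z d"
| "time_bound Z (Cond b c d) = time_bound Z c + time_bound Z d + 1"
| "time_bound Z (While b c) = Z * (time_bound Z c + 1) + 1"

text \<open>Sequencing adds and a loop multiplies by \<open>Z\<close>, so the degree is fixed by the
  program text. The exponent \<open>d1 + d2\<close> serves both halves because powers of a positive
  \<open>Z\<close> are monotone in the exponent.\<close>

lemma time_bound_polynomial: "\<exists>a d. \<forall>Z\<ge>1. time_bound Z c \<le> a * Z ^ d"
proof (induction c)
  case (Seq c1 c2)
  then obtain a1 d1 a2 d2 where
    h: "\<And>Z. Z \<ge> 1 \<Longrightarrow> time_bound Z c1 \<le> a1 * Z ^ d1" "\<And>Z. Z \<ge> 1 \<Longrightarrow> time_bound Z c2 \<le> a2 * Z ^ d2" by blast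
  have "time_bound Z (Seq c1 c2) \<le> (a1 + a2) * Z ^ (d1 + d2)" if "Z \<ge> 1" for Z
  proof -
    have "Z ^ d1 \<le> Z ^ (d1 + d2)" "Z ^ d2 \<le> Z ^ (d1 + d2)" using that by (auto intro: power_increasing)
    then have "a1 * Z ^ d1 + a2 * Z ^ d2 \<le> (a1 + a2) * Z ^ (d1 + d2)"
      unfolding add_mult_distrib by (intro add_mono mult_le_mono) auto
    then show ?thesis using h[OF that] by simp
  qed
  then show ?case by blast
next
  case (Cond b c1 c2)
  then obtain a1 d1 a2 d2 where
    h: "\<And>Z. Z \<ge> 1 \<Longrightarrow> time_bound Z c1 \<le> a1 * Z ^ d1" "\<And>Z. Z \<ge> 1 \<Longrightarrow> time_bound Z c2 \<le> a2 * Z ^ d2" by blast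
  have "time_bound Z (Cond b c1 c2) \<le> (a1 + a2 + 1) * Z ^ (d1 + d2)" if "Z \<ge> 1" for Z
  proof -
    have "Z ^ d1 \<le> Z ^ (d1 + d2)" "Z ^ d2 \<le> Z ^ (d1 + d2)" using that by (auto intro: power_increasing)
    then have "a1 * Z ^ d1 + a2 * Z ^ d2 \<le> (a1 + a2) * Z ^ (d1 + d2)"
      unfolding add_mult_distrib by (intro add_mono mult_le_mono) auto
    moreover have "1 \<le> Z ^ (d1 + d2)" using that by simp
    ultimately show ?thesis using h[OF that] by (simp add: add_mult_distrib)
  qed
  then show ?case by blast
next
  case (While b c)
  then obtain a d where h: "\<And>Z. Z \<ge> 1 \<Longrightarrow> time_bound Z c \<le> a * Z ^ d" by blast
  \<comment> \<open>The extra 2 absorbs the tests: the \<open>Z\<close> successful ones together,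
    and the final failing one.\<close>
  have "time_bound Z (While b c) \<le> (a + 2) * Z ^ Suc d" if "Z \<ge> 1" for Z
  proof -
    have "Z * time_bound Z c \<le> a * Z ^ Suc d"
      using mult_le_mono2[OF h[OF that], of Z] by (simp add: mult_ac)
    moreover have "Z \<le> Z ^ Suc d" "1 \<le> Z ^ Suc d" using that by (auto intro: self_le_power)
    ultimately have "Z * time_bound Z c + Z + 1 \<le> a * Z ^ Suc d + Z ^ Suc d + Z ^ Suc d" by linarith
    also have "\<dots> = (a + 2) * Z ^ Suc d" by (simp only: add_mult_distrib mult_2 add.assoc)
    finally show ?thesis by (simp only: time_bound.simps distrib_left mult_1_right)
  qed
  then show ?case by blast
qed (rule exI[of _ 1], rule exI[of _ 0], simp)+

text \<open>Fixing the bound to the syntactic \<open>time_bound Z c\<close> keeps time out of later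
  reasoning: the rules carry only postconditions, and what remains to check is that loops stop
  within \<open>Z\<close> rounds. A postcondition may itself be a \<open>runs\<close> statement, so
  the rules compose backwards.\<close>

definition runs :: "nat \<Rightarrow> com \<Rightarrow> state \<Rightarrow> (state \<Rightarrow> bool) \<Rightarrow> bool" where
  "runs Z c s Q \<longleftrightarrow> (\<exists>t s'. exec c s t s' \<and> t \<le> time_bound Z c \<and> Q s')"

lemma runs_skip: "Q s \<Longrightarrow> runs Z Skip s Q"
  unfolding runs_def by (intro exI conjI, rule exec.Skip) simp_all

lemma runs_nstore: "Q (store a (nval i s) (nval e s) (fst s), snd s) \<Longrightarrow> runs Z (NStore a i e) s Q"
  unfolding runs_def by (intro exI conjI, rule exec.NStore) simp_all

lemma runs_rstore: "Q (fst s, store a (nval i s) (rval e s) (snd s)) \<Longrightarrow> runs Z (RStore a i e) s Q"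
  unfolding runs_def by (intro exI conjI, rule exec.RStore) simp_all

lemma runs_seq:
  assumes "runs Z c s (\<lambda>s'. runs Z d s' Q)"
  shows "runs Z (Seq c d) s Q"
proof -
  obtain t s' t' s'' where "exec c s t s'" "t \<le> time_bound Z c" "exec d s' t' s''" "t' \<le> time_bound Z d" "Q s''"
    using assms unfolding runs_def by blast
  then show ?thesis
    unfolding runs_def using exec.Seq[of c s t s' d t' s'']
    by (intro exI[of _ "t + t'"] exI[of _ s'']) simp
qed

lemma runs_cond:
  assumes "bval b s \<Longrightarrow> runs Z c s Q" "\<not> bval b s \<Longrightarrow> runs Z d s Q"
  shows "runs Z (Cond b c d) s Q"
proof (cases "bval b s")
  case True
  then obtain t s' where "exec c s t s'" "t \<le> time_bound Z c" "Q s'" using assms unfolding runs_def by blast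
  then show ?thesis unfolding runs_def using exec.CondTrue[OF True, of c t s' d]
    by (intro exI[of _ "t + 1"] exI[of _ s']) simp
next
  case False
  then obtain t s' where "exec d s t s'" "t \<le> time_bound Z d" "Q s'" using assms unfolding runs_def by blast
  then show ?thesis unfolding runs_def using exec.CondFalse[OF False, of d t s' c]
    by (intro exI[of _ "t + 1"] exI[of _ s']) simp
qed

lemma runs_conseq:
  assumes "runs Z c s P" "\<And>s'. P s' \<Longrightarrow> frame c s s' \<Longrightarrow> Q s'"
  shows "runs Z c s Q"
  using assms exec_frame unfolding runs_def by blast

lemma runs_seq_frame:
  assumes "runs Z c s P" "\<And>s'. P s' \<Longrightarrow> frame c s s' \<Longrightarrow> runs Z d s' Q"
  shows "runs Z (Seq c d) s Q"
  by (rule runs_seq, rule runs_conseq[OF assms])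

text \<open>The invariant is indexed by the round, and the exact number \<open>N\<close> of rounds
  is known beforehand; this yields termination and the time bound together. Each round may also use
  that everything outside the writes of the body agrees with the start state.\<close>

lemma runs_while:
  assumes N: "N \<le> Z" and I0: "I 0 s0"
    and step: "\<And>k s. k < N \<Longrightarrow> I k s \<Longrightarrow> frame c s0 s \<Longrightarrow> bval b s \<and> runs Z c s (I (Suc k))"
    and stop: "\<And>s. I N s \<Longrightarrow> frame c s0 s \<Longrightarrow> \<not> bval b s"
    and post: "\<And>s. I N s \<Longrightarrow> frame c s0 s \<Longrightarrow> Q s"
  shows "runs Z (While b c) s0 Q"
proof -
  \<comment> \<open>Generalised to \<open>r\<close> remaining rounds: each pays for the body and one
    test, and the last 1 is the failing test.\<close>
  have "\<exists>t s'. exec (While b c) s t s' \<and> t \<le> r * (time_bound Z c + 1) + 1 \<and> Q s'"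
    if "I k s" "frame c s0 s" "k + r = N" for k r s
    using that
  proof (induction r arbitrary: k s)
    case 0
    then have "exec (While b c) s 1 s" "Q s" using WhileFalse[of b s c] stop[of s] post[of s] by simp_all
    then show ?case by (intro exI[of _ 1] exI[of _ s]) simp
  next
    case (Suc r)
    then have b: "bval b s" and "runs Z c s (I (Suc k))" using step[of k s] by auto
    then obtain t s' where e: "exec c s t s'" "t \<le> time_bound Z c" "I (Suc k) s'" unfolding runs_def by blast
    then have "frame c s0 s'" using exec_frame frame_trans Suc.prems by blast
    then obtain t' s'' where "exec (While b c) s' t' s''" "t' \<le> r * (time_bound Z c + 1) + 1" "Q s''"
      using Suc.IH[of "Suc k" s'] e Suc.prems by auto
    then show ?case using WhileTrue[OF b e(1), of t' s''] e(2)
      by (intro exI[of _ "t + t' + 1"] exI[of _ s'']) auto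
  qed
  from this[of 0 s0 N] I0 obtain t s' where
    "exec (While b c) s0 t s'" "t \<le> N * (time_bound Z c + 1) + 1" "Q s'" by (auto simp: frame_refl)
  moreover have "N * (time_bound Z c + 1) + 1 \<le> time_bound Z (While b c)" using mult_le_mono1[OF N, of "time_bound Z c + 1"] by simp
  ultimately show ?thesis unfolding runs_def by (meson le_trans)
qed

section \<open>Counting loops\<close>

abbreviation var :: "vname \<Rightarrow> nexp" where
  "var x \<equiv> NLoad x (NConst 0)"

abbreviation assign :: "vname \<Rightarrow> nexp \<Rightarrow> com" where
  "assign x e \<equiv> NStore x (NConst 0) e"

abbreviation nless :: "nexp \<Rightarrow> nexp \<Rightarrow> bexp" where
  "nless e f \<equiv> NLe (NAdd e (NConst 1)) f"

definition for_loop :: "vname \<Rightarrow> nexp \<Rightarrow> com \<Rightarrow> com" where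
  "for_loop x e c = Seq (assign x (NConst 0))
     (While (nless (var x) e) (Seq c (assign x (NAdd (var x) (NConst 1)))))"

lemma nat_writes_for_loop [simp]: "nat_writes (for_loop x e c) = insert x (nat_writes c)"
  and real_writes_for_loop [simp]: "real_writes (for_loop x e c) = real_writes c"
  by (auto simp: for_loop_def)

text \<open>\<open>indep\<close> is there because the counter is reset and incremented outside the
  body, where the invariant has to survive; \<open>bound\<close> because the limit \<open>e\<close>
  is evaluated anew at each test.\<close>

lemma runs_for_loop:
  assumes N: "N \<le> Z" and x: "x \<notin> nat_writes c"
    and bound: "\<And>s. frame (for_loop x e c) s0 s \<Longrightarrow> nval e s = N"
    and indep: "\<And>k s v. I k s \<Longrightarrow> I k (store x 0 v (fst s), snd s)"
    and I0: "I 0 s0"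
    and step: "\<And>k s. k < N \<Longrightarrow> I k s \<Longrightarrow> frame (for_loop x e c) s0 s \<Longrightarrow> fst s x 0 = k \<Longrightarrow>
      runs Z c s (I (Suc k))"
    and post: "\<And>s. I N s \<Longrightarrow> frame (for_loop x e c) s0 s \<Longrightarrow> Q s"
  shows "runs Z (for_loop x e c) s0 Q"
proof -
  let ?c = "for_loop x e c"
  define J where "J k s \<longleftrightarrow> I k s \<and> frame ?c s0 s \<and> fst s x 0 = k" for k s
  have upd: "frame ?c s (store x 0 v (fst s), snd s)" for s v
    by (simp add: frame_def store_def)
  show ?thesis
    unfolding for_loop_def
  proof (rule runs_seq, rule runs_nstore, rule runs_while[where I = J, OF N])
    show "J 0 (store x (nval (NConst 0) s0) (nval (NConst 0) s0) (fst s0), snd s0)"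
      using indep[OF I0] upd[of s0 0] by (simp add: J_def) (simp add: store_def)
  next
    fix k s assume k: "k < N" and J: "J k s"
    have "runs Z c s (I (Suc k))" using step k J unfolding J_def by blast
    then have "runs Z c s (\<lambda>s'. J (Suc k) (store x 0 (Suc k) (fst s'), snd s') \<and> fst s' x 0 = k)"
    proof (rule runs_conseq)
      fix s' assume "I (Suc k) s'" and c: "frame c s s'"
      moreover have "frame ?c s0 (store x 0 (Suc k) (fst s'), snd s')"
      proof (rule frame_trans[OF frame_trans])
        show "frame ?c s0 s" using J by (simp add: J_def)
        show "frame ?c s s'" by (rule frame_mono[OF c]) auto
      qed (rule upd)
      ultimately show "J (Suc k) (store x 0 (Suc k) (fst s'), snd s') \<and> fst s' x 0 = k"
        using indep[of "Suc k" s' "Suc k"] J frame_nat[OF c x] unfolding J_def by (simp add: store_def)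
    qed
    then have "runs Z (Seq c (assign x (NAdd (var x) (NConst 1)))) s (J (Suc k))"
      by (intro runs_seq) (erule runs_conseq, rule runs_nstore, simp)
    then show "bval (nless (var x) e) s \<and>
        runs Z (Seq c (assign x (NAdd (var x) (NConst 1)))) s (J (Suc k))"
      using k J bound unfolding J_def by simp
  next
    fix s assume "J N s"
    then show "\<not> bval (nless (var x) e) s" and "Q s"
      using bound post unfolding J_def by auto
  qed
qed

section \<open>Components and trees\<close>

lemma adj_sym: "(x, y) \<in> adj E \<Longrightarrow> (y, x) \<in> adj E"
  by (simp add: adj_def insert_commute)

lemma adj_rtrancl_sym: "(x, y) \<in> (adj E)\<^sup>* \<Longrightarrow> (y, x) \<in> (adj E)\<^sup>*"
  by (induction rule: rtrancl_induct) (auto intro: adj_sym converse_rtrancl_into_rtrancl)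

lemma adj_rtrancl_mono: "(x, y) \<in> (adj E)\<^sup>* \<Longrightarrow> E \<subseteq> F \<Longrightarrow> (x, y) \<in> (adj F)\<^sup>*"
  by (rule rtrancl_mono[THEN subsetD]) (auto simp: adj_def)

lemma adj_rtrancl_closed:
  assumes "(x, y) \<in> (adj E)\<^sup>*" "x \<in> S" "\<And>u v. u \<in> S \<Longrightarrow> {u, v} \<in> E \<Longrightarrow> v \<in> S"
  shows "y \<in> S"
  using assms(1,2) by (induction rule: rtrancl_induct) (auto simp: adj_def intro: assms(3))

lemma rtrancl_simple_path:
  assumes "(u, v) \<in> r\<^sup>*"
  shows "\<exists>p. p \<noteq> [] \<and> p ! 0 = u \<and> last p = v \<and> distinct p \<and>
    (\<forall>i. Suc i < length p \<longrightarrow> (p ! i, p ! Suc i) \<in> r)"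
  using assms
proof (induction rule: rtrancl_induct)
  case base
  then show ?case by (intro exI[of _ "[u]"]) simp
next
  case (step y z)
  then obtain p where p: "p \<noteq> []" "p ! 0 = u" "last p = y" "distinct p"
    "\<And>i. Suc i < length p \<Longrightarrow> (p ! i, p ! Suc i) \<in> r" by blast
  show ?case
  proof (cases "z \<in> set p")
    \<comment> \<open>A return to a visited vertex is undone by truncating the path just after that
      vertex.\<close>
    case True
    then obtain k where k: "k < length p" "p ! k = z" by (auto simp: in_set_conv_nth)
    have "last (take (Suc k) p) = z" using k by (simp add: take_Suc_conv_app_nth)
    then show ?thesis using p k by (intro exI[of _ "take (Suc k) p"]) auto
  next
    case False
    have "((p @ [z]) ! i, (p @ [z]) ! Suc i) \<in> r" if "Suc i < length (p @ [z])" for i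
    proof (cases "Suc i < length p")
      case True
      then show ?thesis using p(5)[of i] by (simp add: nth_append)
    next
      case False
      then have "i = length p - 1" "Suc i = length p" using that by auto
      then show ?thesis using p(1,3) step.hyps(2) by (simp add: nth_append last_conv_nth)
    qed
    then show ?thesis using p False by (intro exI[of _ "p @ [z]"]) (auto simp: nth_append)
  qed
qed

text \<open>A simple path from \<open>u\<close> to \<open>v\<close> inside \<open>D\<close> cannot
  be the edge \<open>{u, v}\<close> itself, so it has at least three vertices, and that edge closes
  it to a cycle.\<close>

lemma cycle_if_redundant_edge:
  assumes "D \<subseteq> E" "{u, v} \<in> E" "{u, v} \<notin> D" "u \<noteq> v" "(u, v) \<in> (adj D)\<^sup>*"
  shows "\<exists>p. is_cycle E p"
proof -
  obtain p where p: "p \<noteq> []" "p ! 0 = u" "last p = v" "distinct p"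
    "\<And>i. Suc i < length p \<Longrightarrow> (p ! i, p ! Suc i) \<in> adj D"
    using rtrancl_simple_path[OF assms(5)] by blast
  have last: "p ! (length p - 1) = v" using p by (simp add: last_conv_nth)
  have "length p \<noteq> 1" using last p(2) assms(4) by auto
  moreover have "length p \<noteq> 2" using last p(2) p(5)[of 0] assms(3) by (auto simp: adj_def)
  moreover have "length p \<noteq> 0" using p(1) by simp
  ultimately have len: "length p \<ge> 3" by linarith
  have "{p ! i, p ! (Suc i mod length p)} \<in> E" if "i < length p" for i
  proof (cases "Suc i < length p")
    case True
    then show ?thesis using p(5)[of i] assms(1) by (auto simp: adj_def)
  next
    case False
    then have "Suc i = length p" using that by simp
    then have "p ! i = v" "Suc i mod length p = 0" using last by (auto simp flip: \<open>Suc i = length p\<close>)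
    then show ?thesis using p(2) assms(2) by (simp add: insert_commute)
  qed
  then have "is_cycle E p" using len p(4) by (simp add: is_cycle_def)
  then show ?thesis ..
qed

text \<open>An edge outside \<open>D\<close> would join two vertices already connected through
  \<open>r\<close> and close a cycle. Thus a search that reaches all vertices has used all edges,
  and no edge count of trees has to be established.\<close>

lemma tree_graph_spanning_subset:
  assumes T: "tree_graph V E" and "D \<subseteq> E" and r: "\<And>x. x \<in> V \<Longrightarrow> (r, x) \<in> (adj D)\<^sup>*"
  shows "D = E"
proof (rule ccontr)
  assume "D \<noteq> E"
  then obtain e where e: "e \<in> E" "e \<notin> D" using assms(2) by blast
  then obtain u v where uv: "e = {u, v}" "u \<noteq> v" "u \<in> V" "v \<in> V"
    using T unfolding tree_graph_def simple_graph_def by (metis card_2_iff insert_subset)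
  have "(u, v) \<in> (adj D)\<^sup>*" using r uv adj_rtrancl_sym rtrancl_trans by metis
  then show False using cycle_if_redundant_edge[of D E u v] e uv assms(2) T
    unfolding tree_graph_def by blast
qed

section \<open>Components under disjoint union and bridging\<close>

lemma component_eq_if_mem:
  assumes "y \<in> component V E x"
  shows "component V E y = component V E x"
proof -
  have "(x, y) \<in> (adj E)\<^sup>*" using assms by (simp add: component_def)
  then have "(y, z) \<in> (adj E)\<^sup>* \<longleftrightarrow> (x, z) \<in> (adj E)\<^sup>*" for z
    using adj_rtrancl_sym rtrancl_trans by metis
  then show ?thesis by (simp add: component_def)
qed

lemma component_refl: "x \<in> V \<Longrightarrow> x \<in> component V E x"
  by (simp add: component_def)

text \<open>No edge of \<open>F2\<close> touches \<open>V1\<close>, so the component within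
  \<open>F1\<close> is already closed under all edges.\<close>

lemma component_disjoint_union:
  assumes "V1 \<inter> V2 = {}" "\<And>e. e \<in> F1 \<Longrightarrow> e \<subseteq> V1" "\<And>e. e \<in> F2 \<Longrightarrow> e \<subseteq> V2" "x \<in> V1"
  shows "component (V1 \<union> V2) (F1 \<union> F2) x = component V1 F1 x"
proof -
  have "y \<in> component V1 F1 x" if "(x, y) \<in> (adj (F1 \<union> F2))\<^sup>*" for y
  proof (rule adj_rtrancl_closed[OF that component_refl[OF \<open>x \<in> V1\<close>]])
    fix u v assume u: "u \<in> component V1 F1 x" and e: "{u, v} \<in> F1 \<union> F2"
    have "{u, v} \<notin> F2" using u assms(1) assms(3)[of "{u, v}"] by (auto simp: component_def)
    then have "{u, v} \<in> F1" using e by simp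
    then show "v \<in> component V1 F1 x" using u assms(2)
      by (auto simp: component_def adj_def intro: rtrancl_into_rtrancl)
  qed
  then show ?thesis by (auto simp: component_def intro: adj_rtrancl_mono)
qed

text \<open>The right-hand side is closed under all edges, which bounds the component from above;
  conversely, a vertex beyond the bridge is reached through \<open>p\<close> and then
  \<open>c\<close>. Swapping the roles of the two sides gives the version for start vertices in
  \<open>V2\<close>.\<close>

lemma component_bridge:
  assumes "V1 \<inter> V2 = {}" "\<And>e. e \<in> F1 \<Longrightarrow> e \<subseteq> V1" "\<And>e. e \<in> F2 \<Longrightarrow> e \<subseteq> V2"
    "p \<in> V1" "c \<in> V2" "x \<in> V1"
  shows "component (V1 \<union> V2) (insert {p, c} (F1 \<union> F2)) x =
    component V1 F1 x \<union> (if p \<in> component V1 F1 x then component V2 F2 c else {})" (is "?L = ?R")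
proof
  let ?F = "insert {p, c} (F1 \<union> F2)"
  show "?L \<subseteq> ?R"
  proof
    fix y assume "y \<in> ?L"
    then have "(x, y) \<in> (adj ?F)\<^sup>*" by (simp add: component_def)
    then show "y \<in> ?R"
    proof (rule adj_rtrancl_closed)
      show "x \<in> ?R" using component_refl[OF \<open>x \<in> V1\<close>] by simp
      fix u v assume u: "u \<in> ?R" and e: "{u, v} \<in> ?F"
      consider "u = p" "v = c" | "u = c" "v = p" | "{u, v} \<in> F1" | "{u, v} \<in> F2"
        using e by (auto simp: doubleton_eq_iff)
      then show "v \<in> ?R"
      proof cases
        case 1
        then have "p \<in> component V1 F1 x" using u assms by (auto simp: component_def split: if_splits)
        then show ?thesis using 1 component_refl[OF \<open>c \<in> V2\<close>] by simp
      next
        case 2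
        then have "p \<in> component V1 F1 x" using u assms by (auto simp: component_def split: if_splits)
        then show ?thesis using 2 by simp
      next
        case 3
        then have "u \<notin> component V2 F2 c"
          using assms(1) assms(2)[of "{u, v}"] by (auto simp: component_def)
        then have "u \<in> component V1 F1 x" using u by (auto split: if_splits)
        then have "v \<in> component V1 F1 x" using 3 assms(2)
          by (auto simp: component_def adj_def intro: rtrancl_into_rtrancl)
        then show ?thesis by simp
      next
        case 4
        then have "u \<notin> component V1 F1 x"
          using assms(1) assms(3)[of "{u, v}"] by (auto simp: component_def)
        then have "p \<in> component V1 F1 x" "u \<in> component V2 F2 c"
          using u by (auto split: if_splits)
        then have "v \<in> component V2 F2 c" using 4 assms(3)
          by (auto simp: component_def adj_def intro: rtrancl_into_rtrancl)
        then show ?thesis using \<open>p \<in> component V1 F1 x\<close> by simp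
      qed
    qed
  qed
  show "?R \<subseteq> ?L"
  proof
    fix y assume y: "y \<in> ?R"
    show "y \<in> ?L"
    proof (cases "y \<in> component V1 F1 x")
      case True
      then show ?thesis by (auto simp: component_def intro: adj_rtrancl_mono)
    next
      case False
      then have p: "p \<in> component V1 F1 x" and y: "y \<in> component V2 F2 c"
        using y by (auto split: if_splits)
      have "(x, p) \<in> (adj ?F)\<^sup>*" "(c, y) \<in> (adj ?F)\<^sup>*"
        using p y by (auto simp: component_def intro: adj_rtrancl_mono)
      moreover have "(p, c) \<in> adj ?F" by (simp add: adj_def)
      ultimately have "(x, y) \<in> (adj ?F)\<^sup>*" by (meson rtrancl_into_rtrancl rtrancl_trans)
      then show ?thesis using y by (simp add: component_def)
    qed
  qed
qed

section \<open>Merging partial solutions\<close>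

text \<open>
  States of a partial solution: 0, the component of the root contains no ignition and is not going to
  burn; 1, it contains an ignition; 2, it contains none yet but is going to burn.
\<close>

definition promise :: "nat \<Rightarrow> real" where
  "promise s = (if s = 0 then 0 else 1)"

definition ignited :: "nat \<Rightarrow> bool" where
  "ignited s \<longleftrightarrow> s = 1"

text \<open>
  Triples of the states of parent, child and merged solution, for a connecting edge that is kept or cut.
\<close>

definition keep_rules :: "(nat \<times> nat \<times> nat) list" where
  "keep_rules = [(0, 0, 0), (1, 1, 1), (1, 2, 1), (2, 1, 1), (2, 2, 2)]"

definition cut_rules :: "(nat \<times> nat \<times> nat) list" where
  "cut_rules = [(0, 0, 0), (0, 1, 0), (1, 0, 1), (1, 1, 1), (2, 0, 2), (2, 1, 2)]"

text \<open>Risks and codes of the two sides add; \<open>d\<close> is the code of the connecting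
  edge when it is cut, and 0 when it is kept.\<close>

definition shifted_sums :: "nat \<Rightarrow> (real \<times> nat) set \<Rightarrow> (real \<times> nat) set \<Rightarrow> (real \<times> nat) set" where
  "shifted_sums d A B = {(a + b, k + l + d) | a k b l. (a, k) \<in> A \<and> (b, l) \<in> B}"

lemma shifted_sumsI:
  "(a, k) \<in> A \<Longrightarrow> (b, l) \<in> B \<Longrightarrow> (a + b, k + l + d) \<in> shifted_sums d A B"
  unfolding shifted_sums_def by blast

lemma shifted_sumsE:
  assumes "q \<in> shifted_sums d A B"
  obtains a k b l where "q = (a + b, k + l + d)" "(a, k) \<in> A" "(b, l) \<in> B"
  using assms unfolding shifted_sums_def mem_Collect_eq by (elim exE conjE)

definition apply_rules :: "(nat \<times> nat \<times> nat) list \<Rightarrow> nat \<Rightarrow> (nat \<Rightarrow> (real \<times> nat) set) \<Rightarrow>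
    (nat \<Rightarrow> (real \<times> nat) set) \<Rightarrow> nat \<Rightarrow> (real \<times> nat) set" where
  "apply_rules R d A B o' = (\<Union>(s, t, s')\<in>set R. if s' = o' then shifted_sums d (A s) (B t) else {})"

text \<open>Here \<open>code\<close> is an arbitrary additive edge weight; powers of two enter only
  when an instance is fixed.\<close>

locale firebreak =
  fixes \<phi> :: "'a \<Rightarrow> real" and ign :: "'a set" and \<kappa> :: "'a set \<Rightarrow> nat" and code :: "'a set \<Rightarrow> nat"
begin

definition burns :: "'a set \<Rightarrow> 'a set set \<Rightarrow> 'a \<Rightarrow> bool" where
  "burns V F x \<longleftrightarrow> component V F x \<inter> ign \<noteq> {}"

text \<open>Later merges can alter only the component of the root, so only there does
  \<open>b\<close> stand in for the actual state.\<close>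

definition promised_risk :: "'a set \<Rightarrow> 'a set set \<Rightarrow> 'a \<Rightarrow> real \<Rightarrow> real" where
  "promised_risk V F r b =
     (\<Sum>x\<in>V. \<phi> x * (if x \<in> component V F r then b else of_bool (burns V F x)))"

text \<open>The cost is bounded by \<open>w\<close> rather than equal to it: a merge can hand the
  whole unspent remainder to the child, and the entry for the full budget already covers all cheaper
  solutions.\<close>

definition candidates :: "'a set \<Rightarrow> 'a set set \<Rightarrow> 'a \<Rightarrow> nat \<Rightarrow> nat \<Rightarrow> (real \<times> nat) set" where
  "candidates V D r s w = {(promised_risk V (D - H) r (promise s), sum code H) | H.
     H \<subseteq> D \<and> sum \<kappa> H \<le> w \<and> burns V (D - H) r = ignited s}"

text \<open>The vertices of the root component have the same component as the root and hence the
  same fate, so a truthful promise changes nothing.\<close>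

lemma promised_risk_burns:
  "promised_risk V F r (of_bool (burns V F r)) = (\<Sum>x\<in>V. \<phi> x * of_bool (burns V F x))"
  unfolding promised_risk_def burns_def by (rule sum.cong) (auto dest: component_eq_if_mem)

lemma candidates_singleton:
  "candidates {v} {} v s w = (if (v \<in> ign) = ignited s then {(\<phi> v * promise s, 0)} else {})"
proof -
  have "component {v} {} v = {v}" by (auto simp: component_def)
  then show ?thesis by (auto simp: candidates_def promised_risk_def burns_def)
qed

section \<open>Gluing two subtrees along one edge\<close>

context
  fixes V1 V2 :: "'a set" and p c :: 'a
  assumes fin: "finite V1" "finite V2" and disj: "V1 \<inter> V2 = {}" and p: "p \<in> V1" and c: "c \<in> V2"
begin

context
  fixes F1 F2 :: "'a set set"
  assumes F1: "\<And>e. e \<in> F1 \<Longrightarrow> e \<subseteq> V1" and F2: "\<And>e. e \<in> F2 \<Longrightarrow> e \<subseteq> V2"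
begin

lemma component_union:
  "x \<in> V1 \<Longrightarrow> component (V1 \<union> V2) (F1 \<union> F2) x = component V1 F1 x"
  "x \<in> V2 \<Longrightarrow> component (V1 \<union> V2) (F1 \<union> F2) x = component V2 F2 x"
  using component_disjoint_union[of V1 V2 F1 F2 x] component_disjoint_union[of V2 V1 F2 F1 x]
    disj F1 F2 by (auto simp: Un_commute Int_commute)

lemma component_insert_bridge:
  "x \<in> V1 \<Longrightarrow> component (V1 \<union> V2) (insert {p, c} (F1 \<union> F2)) x =
     component V1 F1 x \<union> (if p \<in> component V1 F1 x then component V2 F2 c else {})"
  "x \<in> V2 \<Longrightarrow> component (V1 \<union> V2) (insert {p, c} (F1 \<union> F2)) x =
     component V2 F2 x \<union> (if c \<in> component V2 F2 x then component V1 F1 p else {})"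
  using component_bridge[of V1 V2 F1 F2 p c x] component_bridge[of V2 V1 F2 F1 c p x]
    disj F1 F2 p c by (auto simp: Un_commute Int_commute insert_commute)

lemma burns_union: "burns (V1 \<union> V2) (F1 \<union> F2) p \<longleftrightarrow> burns V1 F1 p"
  by (simp add: burns_def component_union p)

text \<open>Without the connecting edge the component of \<open>c\<close> is final and counts with
  its actual state; the promise still concerns only the component of \<open>p\<close>, which lies in
  \<open>V1\<close>.\<close>

lemma promised_risk_union:
  "promised_risk (V1 \<union> V2) (F1 \<union> F2) p b =
     promised_risk V1 F1 p b + promised_risk V2 F2 c (of_bool (burns V2 F2 c))"
proof -
  have "x \<notin> component V1 F1 p" if "x \<in> V2" for x using that disj by (auto simp: component_def)
  then show ?thesis
    unfolding promised_risk_burns unfolding promised_risk_def sum.union_disjoint[OF fin disj]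
    by (intro arg_cong2[where f = "(+)"] sum.cong) (auto simp: component_union p burns_def)
qed

lemma burns_bridge:
  "burns (V1 \<union> V2) (insert {p, c} (F1 \<union> F2)) p \<longleftrightarrow> burns V1 F1 p \<or> burns V2 F2 c"
  using component_refl[OF p, of F1] by (auto simp: burns_def component_insert_bridge p)

text \<open>The components of \<open>p\<close> and \<open>c\<close> fuse and share one fate, so both
  halves are evaluated under the same promise; all other components are unchanged.\<close>

lemma promised_risk_bridge:
  "promised_risk (V1 \<union> V2) (insert {p, c} (F1 \<union> F2)) p b =
     promised_risk V1 F1 p b + promised_risk V2 F2 c b"
proof -
  let ?F = "insert {p, c} (F1 \<union> F2)" and ?C = "component (V1 \<union> V2) (insert {p, c} (F1 \<union> F2)) p"
  have C: "?C = component V1 F1 p \<union> component V2 F2 c"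
    using component_refl[OF p, of F1] by (simp add: component_insert_bridge p)
  have mem: "x \<in> ?C \<longleftrightarrow> x \<in> component V1 F1 p" if "x \<in> V1" for x
    using that disj C by (auto simp: component_def)
  have mem': "x \<in> ?C \<longleftrightarrow> x \<in> component V2 F2 c" if "x \<in> V2" for x
    using that disj C by (auto simp: component_def)
  have "burns (V1 \<union> V2) ?F x = burns V1 F1 x" if "x \<in> V1" "x \<notin> component V1 F1 p" for x
    using that component_eq_if_mem[of p V1 F1 x] component_refl[of x V1 F1]
    by (auto simp: burns_def component_insert_bridge)
  moreover have "burns (V1 \<union> V2) ?F x = burns V2 F2 x" if "x \<in> V2" "x \<notin> component V2 F2 c" for x
    using that component_eq_if_mem[of c V2 F2 x] component_refl[of x V2 F2]
    by (auto simp: burns_def component_insert_bridge)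
  ultimately show ?thesis
    unfolding promised_risk_def sum.union_disjoint[OF fin disj]
    by (intro arg_cong2[where f = "(+)"] sum.cong) (auto simp: mem mem')
qed

end

context
  fixes D1 D2 :: "'a set set"
  assumes D1: "\<And>e. e \<in> D1 \<Longrightarrow> e \<subseteq> V1 \<and> e \<noteq> {}" and D2: "\<And>e. e \<in> D2 \<Longrightarrow> e \<subseteq> V2 \<and> e \<noteq> {}"
begin

abbreviation "whole w \<equiv> \<lambda>s. candidates (V1 \<union> V2) (insert {p, c} (D1 \<union> D2)) p s w"
abbreviation "parent w \<equiv> \<lambda>s. candidates V1 D1 p s w"
abbreviation "child w \<equiv> \<lambda>s. candidates V2 D2 c s w"

text \<open>The bridge meets both sides, while other edges stay within one. Only an empty edge could
  belong to both sides, and edges are nonempty.\<close>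

lemma bridge_notin: "{p, c} \<notin> D1" "{p, c} \<notin> D2" "D1 \<inter> D2 = {}"
  using D1 D2 disj p c by blast+

lemma finite_edges: "finite D1" "finite D2"
  using D1 D2 fin by (auto intro: finite_subset[of _ "Pow _"])

lemma sum_split:
  fixes f :: "'a set \<Rightarrow> nat"
  assumes "H1 \<subseteq> D1" "H2 \<subseteq> D2"
  shows "sum f (H1 \<union> H2) = sum f H1 + sum f H2"
    and "sum f (insert {p, c} (H1 \<union> H2)) = sum f H1 + sum f H2 + f {p, c}"
proof -
  have "finite H1" "finite H2" using assms finite_edges finite_subset by auto
  moreover have "H1 \<inter> H2 = {}" "{p, c} \<notin> H1 \<union> H2" using assms bridge_notin by blast+
  ultimately show "sum f (H1 \<union> H2) = sum f H1 + sum f H2"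
    and "sum f (insert {p, c} (H1 \<union> H2)) = sum f H1 + sum f H2 + f {p, c}"
    by (simp_all add: sum.union_disjoint)
qed

lemma edges_minus:
  assumes "H1 \<subseteq> D1" "H2 \<subseteq> D2"
  shows "insert {p, c} (D1 \<union> D2) - (H1 \<union> H2) = insert {p, c} ((D1 - H1) \<union> (D2 - H2))"
    and "insert {p, c} (D1 \<union> D2) - insert {p, c} (H1 \<union> H2) = (D1 - H1) \<union> (D2 - H2)"
  using assms bridge_notin by blast+

text \<open>A kept edge forces equal promises and pools the ignitions; these conditions determine
  the listed triples. The bounds on \<open>s\<close> and \<open>t\<close> are stated because
  \<open>promise\<close> treats all nonzero numbers alike.\<close>

lemma keep_rules_iff:
  "s' < 3 \<Longrightarrow> (s, t, s') \<in> set keep_rules \<longleftrightarrow> s < 3 \<and> t < 3 \<and>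
    promise s = promise s' \<and> promise t = promise s' \<and> (ignited s \<or> ignited t) = ignited s'"
  by (auto simp: keep_rules_def promise_def ignited_def less_Suc_eq numeral_eq_Suc split: if_splits)

text \<open>Cutting leaves the state of the parent alone but finalises the child, where an
  unfulfilled promise, state 2, is therefore excluded.\<close>

lemma cut_rules_iff:
  "s' < 3 \<Longrightarrow> (s, t, s') \<in> set cut_rules \<longleftrightarrow> s = s' \<and> t = of_bool (ignited t)"
  by (auto simp: cut_rules_def ignited_def less_Suc_eq numeral_eq_Suc)

lemma keep_sound:
  assumes s': "s' < 3" and w: "w1 + w2 \<le> w"
    and R: "(s, t, s') \<in> set keep_rules"
  shows "shifted_sums 0 (parent w1 s) (child w2 t) \<subseteq> whole w s'"
proof -
  note r = R[unfolded keep_rules_iff[OF s']]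
  have "(a + b, k + l) \<in> whole w s'" if A: "(a, k) \<in> parent w1 s" and B: "(b, l) \<in> child w2 t" for a k b l
  proof -
    obtain H1 where H1: "H1 \<subseteq> D1" "a = promised_risk V1 (D1 - H1) p (promise s)" "k = sum code H1"
      "sum \<kappa> H1 \<le> w1" "burns V1 (D1 - H1) p = ignited s" using A unfolding candidates_def by blast
    obtain H2 where H2: "H2 \<subseteq> D2" "b = promised_risk V2 (D2 - H2) c (promise t)" "l = sum code H2"
      "sum \<kappa> H2 \<le> w2" "burns V2 (D2 - H2) c = ignited t" using B unfolding candidates_def by blast
    show ?thesis unfolding candidates_def mem_Collect_eq
    proof (intro exI conjI)
      show "H1 \<union> H2 \<subseteq> insert {p, c} (D1 \<union> D2)" using H1 H2 by blast
      show "sum \<kappa> (H1 \<union> H2) \<le> w" using sum_split(1)[OF H1(1) H2(1), of \<kappa>] H1 H2 w by simp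
      have D: "\<And>e. e \<in> D1 - H1 \<Longrightarrow> e \<subseteq> V1" "\<And>e. e \<in> D2 - H2 \<Longrightarrow> e \<subseteq> V2" using D1 D2 by auto
      show "burns (V1 \<union> V2) (insert {p, c} (D1 \<union> D2) - (H1 \<union> H2)) p = ignited s'"
        using burns_bridge[of "D1 - H1" "D2 - H2", OF D] H1 H2 r by (simp add: edges_minus)
      show "(a + b, k + l) = (promised_risk (V1 \<union> V2) (insert {p, c} (D1 \<union> D2) - (H1 \<union> H2)) p
          (promise s'), sum code (H1 \<union> H2))"
        using promised_risk_bridge[of "D1 - H1" "D2 - H2", OF D] H1 H2 r sum_split(1)[OF H1(1) H2(1), of code] by (simp add: edges_minus)
    qed
  qed
  then show ?thesis by (auto simp: shifted_sums_def)
qed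

lemma cut_sound:
  assumes s': "s' < 3" and w: "w1 + w2 + \<kappa> {p, c} \<le> w"
    and R: "(s, t, s') \<in> set cut_rules"
  shows "shifted_sums (code {p, c}) (parent w1 s) (child w2 t) \<subseteq> whole w s'"
proof -
  note r = R[unfolded cut_rules_iff[OF s']]
  have "(a + b, k + l + code {p, c}) \<in> whole w s'" if A: "(a, k) \<in> parent w1 s" and B: "(b, l) \<in> child w2 t" for a k b l
  proof -
    obtain H1 where H1: "H1 \<subseteq> D1" "a = promised_risk V1 (D1 - H1) p (promise s)" "k = sum code H1"
      "sum \<kappa> H1 \<le> w1" "burns V1 (D1 - H1) p = ignited s" using A unfolding candidates_def by blast
    obtain H2 where H2: "H2 \<subseteq> D2" "b = promised_risk V2 (D2 - H2) c (promise t)" "l = sum code H2"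
      "sum \<kappa> H2 \<le> w2" "burns V2 (D2 - H2) c = ignited t" using B unfolding candidates_def by blast
    \<comment> \<open>The child is in state 0 or 1, where the promise coincides with the truth, as
      \<open>promised_risk_union\<close> demands.\<close>
    have t: "promise t = of_bool (burns V2 (D2 - H2) c)"
      using r H2 by (auto simp: promise_def ignited_def)
    show ?thesis unfolding candidates_def mem_Collect_eq
    proof (intro exI conjI)
      let ?H = "insert {p, c} (H1 \<union> H2)"
      show "?H \<subseteq> insert {p, c} (D1 \<union> D2)" using H1 H2 by blast
      show "sum \<kappa> ?H \<le> w" using sum_split(2)[OF H1(1) H2(1), of \<kappa>] H1 H2 w by simp
      have D: "\<And>e. e \<in> D1 - H1 \<Longrightarrow> e \<subseteq> V1" "\<And>e. e \<in> D2 - H2 \<Longrightarrow> e \<subseteq> V2" using D1 D2 by auto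
      show "burns (V1 \<union> V2) (insert {p, c} (D1 \<union> D2) - ?H) p = ignited s'"
        using burns_union[of "D1 - H1" "D2 - H2", OF D] H1(5) r unfolding edges_minus[OF H1(1) H2(1)] by simp
      show "(a + b, k + l + code {p, c}) = (promised_risk (V1 \<union> V2) (insert {p, c} (D1 \<union> D2) - ?H) p
          (promise s'), sum code ?H)"
        using promised_risk_union[of "D1 - H1" "D2 - H2", OF D] H1 H2 r t sum_split(2)[OF H1(1) H2(1), of code]
        unfolding edges_minus[OF H1(1) H2(1)] by simp
    qed
  qed
  then show ?thesis by (auto simp: shifted_sums_def)
qed

text \<open>A solution splits into its edges on either side and possibly the bridge. The exact cost
  of the parent's part is taken as \<open>w1\<close>, which leaves the child enough.\<close>

lemma candidates_complete:
  assumes s': "s' < 3" and q: "q \<in> whole w s'"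
  shows "(\<exists>w1\<le>w. q \<in> apply_rules keep_rules 0 (parent w1) (child (w - w1)) s') \<or>
    (\<exists>w1. \<kappa> {p, c} + w1 \<le> w \<and>
       q \<in> apply_rules cut_rules (code {p, c}) (parent w1) (child (w - w1 - \<kappa> {p, c})) s')"
proof -
  obtain H where H: "H \<subseteq> insert {p, c} (D1 \<union> D2)" "sum \<kappa> H \<le> w"
    "burns (V1 \<union> V2) (insert {p, c} (D1 \<union> D2) - H) p = ignited s'"
    "q = (promised_risk (V1 \<union> V2) (insert {p, c} (D1 \<union> D2) - H) p (promise s'), sum code H)"
    using q unfolding candidates_def by blast
  define H1 where "H1 = H \<inter> D1"
  define H2 where "H2 = H \<inter> D2"
  have sub: "H1 \<subseteq> D1" "H2 \<subseteq> D2" by (auto simp: H1_def H2_def)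
  have D: "\<And>e. e \<in> D1 - H1 \<Longrightarrow> e \<subseteq> V1" "\<And>e. e \<in> D2 - H2 \<Longrightarrow> e \<subseteq> V2" using D1 D2 by auto
  let ?i1 = "burns V1 (D1 - H1) p" and ?i2 = "burns V2 (D2 - H2) c"
  have par: "(promised_risk V1 (D1 - H1) p (promise s), sum code H1) \<in> parent (sum \<kappa> H1) s"
    if "?i1 = ignited s" for s
    using that sub unfolding candidates_def by blast
  have chi: "(promised_risk V2 (D2 - H2) c (promise t), sum code H2) \<in> child w2 t"
    if "?i2 = ignited t" "sum \<kappa> H2 \<le> w2" for t w2
    using that sub unfolding candidates_def by blast
  show ?thesis
  proof (cases "{p, c} \<in> H")
    case False
    then have eq: "H = H1 \<union> H2" using H(1) by (auto simp: H1_def H2_def)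
    have "(?i1 \<or> ?i2) = ignited s'"
      using H(3) burns_bridge[of "D1 - H1" "D2 - H2", OF D] unfolding eq edges_minus[OF sub] by simp
    \<comment> \<open>An ignition forces state 1; a half without one adopts the promise of the
      merged solution, which gives 0 or 2.\<close>
    define state where "state b = (if b then 1 else if s' = 0 then 0 else 2 :: nat)" for b
    have i: "ignited (state b) = b" for b by (simp add: state_def ignited_def)
    have r: "(state ?i1, state ?i2, s') \<in> set keep_rules"
      unfolding keep_rules_iff[OF s'] i
      using s' \<open>(?i1 \<or> ?i2) = ignited s'\<close> by (auto simp: state_def promise_def ignited_def)
    then have pr: "promise (state ?i1) = promise s'" "promise (state ?i2) = promise s'"
      unfolding keep_rules_iff[OF s'] by auto
    have le: "sum \<kappa> H1 + sum \<kappa> H2 \<le> w" using H(2) sum_split(1)[OF sub, of \<kappa>] by (simp add: eq)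
    have "q = (promised_risk V1 (D1 - H1) p (promise s') + promised_risk V2 (D2 - H2) c (promise s'),
        sum code H1 + sum code H2 + 0)"
      using H(4) promised_risk_bridge[of "D1 - H1" "D2 - H2", OF D] sum_split(1)[OF sub, of code]
      unfolding eq edges_minus[OF sub] by simp
    moreover have "(promised_risk V1 (D1 - H1) p (promise s'), sum code H1) \<in> parent (sum \<kappa> H1) (state ?i1)"
      using par[of "state ?i1", OF i[symmetric]] unfolding pr .
    moreover have "(promised_risk V2 (D2 - H2) c (promise s'), sum code H2) \<in> child (w - sum \<kappa> H1) (state ?i2)"
      using chi[of "state ?i2" "w - sum \<kappa> H1", OF i[symmetric]] le unfolding pr by simp
    ultimately have "q \<in> shifted_sums 0 (parent (sum \<kappa> H1) (state ?i1)) (child (w - sum \<kappa> H1) (state ?i2))"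
      using shifted_sumsI by metis
    then have "q \<in> apply_rules keep_rules 0 (parent (sum \<kappa> H1)) (child (w - sum \<kappa> H1)) s'"
      using r unfolding apply_rules_def by (intro UN_I[OF r]) simp
    then show ?thesis using le by auto
  next
    case True
    then have eq: "H = insert {p, c} (H1 \<union> H2)" using H(1) by (auto simp: H1_def H2_def)
    have i1: "?i1 = ignited s'"
      using H(3) burns_union[of "D1 - H1" "D2 - H2", OF D] unfolding eq edges_minus[OF sub] by simp
    \<comment> \<open>A child that is cut off has to be in the state that tells the truth about its
      burning.\<close>
    define t :: nat where "t = of_bool ?i2"
    have t: "?i2 = ignited t" "promise t = of_bool ?i2" by (auto simp: t_def ignited_def promise_def)
    have r: "(s', t, s') \<in> set cut_rules"
      unfolding cut_rules_iff[OF s'] using t by (auto simp: t_def)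
    have le: "sum \<kappa> H1 + sum \<kappa> H2 + \<kappa> {p, c} \<le> w"
      using H(2) sum_split(2)[OF sub, of \<kappa>] by (simp add: eq)
    have "q = (promised_risk V1 (D1 - H1) p (promise s') + promised_risk V2 (D2 - H2) c (promise t),
        sum code H1 + sum code H2 + code {p, c})"
      using H(4) promised_risk_union[of "D1 - H1" "D2 - H2", OF D] sum_split(2)[OF sub, of code] t
      unfolding eq edges_minus[OF sub] by simp
    moreover have "(promised_risk V2 (D2 - H2) c (promise t), sum code H2) \<in>
        child (w - sum \<kappa> H1 - \<kappa> {p, c}) t"
      using chi[OF t(1), of "w - sum \<kappa> H1 - \<kappa> {p, c}"] le by simp
    ultimately have "q \<in> shifted_sums (code {p, c}) (parent (sum \<kappa> H1) s')
        (child (w - sum \<kappa> H1 - \<kappa> {p, c}) t)"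
      using shifted_sumsI[OF par[OF i1]] by metis
    then have "q \<in> apply_rules cut_rules (code {p, c}) (parent (sum \<kappa> H1))
        (child (w - sum \<kappa> H1 - \<kappa> {p, c})) s'"
      using r unfolding apply_rules_def by (intro UN_I[OF r]) simp
    then show ?thesis using le by (intro disjI2 exI[of _ "sum \<kappa> H1"]) simp
  qed
qed

text \<open>The Bellman recursion as an equation between sets instead of minima: a program can build
  the union term by term while keeping a least element of what has been added so far.\<close>

lemma candidates_merge:
  assumes s': "s' < 3"
  shows "whole w s' = (\<Union>w1<Suc w. apply_rules keep_rules 0 (parent w1) (child (w - w1)) s' \<union>
    (if \<kappa> {p, c} + w1 \<le> w
     then apply_rules cut_rules (code {p, c}) (parent w1) (child (w - w1 - \<kappa> {p, c})) s' else {}))"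
    (is "_ = ?R")
proof
  show "whole w s' \<subseteq> ?R"
  proof
    fix q assume "q \<in> whole w s'"
    from candidates_complete[OF s' this] show "q \<in> ?R"
    proof (elim disjE exE conjE)
      fix w1 assume "w1 \<le> w" "q \<in> apply_rules keep_rules 0 (parent w1) (child (w - w1)) s'"
      then show ?thesis by (intro UN_I[of w1]) auto
    next
      fix w1 assume "\<kappa> {p, c} + w1 \<le> w"
        "q \<in> apply_rules cut_rules (code {p, c}) (parent w1) (child (w - w1 - \<kappa> {p, c})) s'"
      then show ?thesis by (intro UN_I[of w1]) auto
    qed
  qed
  have "apply_rules keep_rules 0 (parent w1) (child (w - w1)) s' \<subseteq> whole w s'" if "w1 \<le> w" for w1
    using keep_sound[OF s', of w1 "w - w1" w] that unfolding apply_rules_def by (fastforce split: if_splits)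
  moreover have "apply_rules cut_rules (code {p, c}) (parent w1) (child (w - w1 - \<kappa> {p, c})) s' \<subseteq> whole w s'"
    if "\<kappa> {p, c} + w1 \<le> w" for w1
    using cut_sound[OF s', of w1 "w - w1 - \<kappa> {p, c}" w] that
    unfolding apply_rules_def by (fastforce split: if_splits)
  ultimately show "?R \<subseteq> whole w s'"
    by (intro UN_least Un_least) (simp_all add: less_Suc_eq_le del: diff_diff_left)
qed

end
end
end

section \<open>Merging tables\<close>

text \<open>
  The arrays of the dynamic programme, one per state; no other array name starts with t.
\<close>

definition tab :: "nat \<Rightarrow> vname" where
  "tab s = replicate (Suc s) CHR ''t''"

lemma tab_inj [simp]: "tab s = tab t \<longleftrightarrow> s = t"
  unfolding tab_def by (metis length_replicate nat.inject)

lemma tab_neq: "a = [] \<or> hd a \<noteq> CHR ''t'' \<Longrightarrow> tab s \<noteq> a"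
  by (auto simp: tab_def)

lemma tab_neq_Cons [simp]: "c \<noteq> CHR ''t'' \<Longrightarrow> c # cs \<noteq> tab s" "c \<noteq> CHR ''t'' \<Longrightarrow> tab s \<noteq> c # cs"
  using tab_neq[of "c # cs" s] by auto

text \<open>
  Codes are stored shifted by one, so that an entry of untouched memory stands for the empty set of
  candidates.
\<close>

definition represents :: "(real \<times> nat) set \<Rightarrow> real \<Rightarrow> nat \<Rightarrow> bool" where
  "represents C r g \<longleftrightarrow> (if g = 0 then C = {} else (r, g - 1) \<in> C \<and> (\<forall>q\<in>C. r \<le> fst q))"

text \<open>The least sum is the sum of the least elements. Both stored codes carry a shift by one,
  and \<open>gb - 1\<close> removes one of them, so the result is shifted exactly once. The two
  claims are the overwriting and the keeping branch of the comparison with the old entry, which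
  survives ties.\<close>

lemma represents_update:
  assumes A: "represents A ra ga" and B: "represents B rb gb" and C: "represents C r g"
  shows "1 \<le> ga \<Longrightarrow> 1 \<le> gb \<Longrightarrow> \<not> (1 \<le> g \<and> r \<le> ra + rb) \<Longrightarrow>
      represents (C \<union> shifted_sums d A B) (ra + rb) (ga + (gb - 1) + d)"
    and "\<not> (1 \<le> ga \<and> 1 \<le> gb \<and> \<not> (1 \<le> g \<and> r \<le> ra + rb)) \<Longrightarrow>
      represents (C \<union> shifted_sums d A B) r g"
proof -
  have le: "ra + rb \<le> fst q" if q: "q \<in> shifted_sums d A B" for q
  proof -
    obtain a k b l where "q = (a + b, k + l + d)" "(a, k) \<in> A" "(b, l) \<in> B"
      using q by (rule shifted_sumsE)
    moreover from this have "ra \<le> a" "rb \<le> b" using A B unfolding represents_def by (auto split: if_splits)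
    ultimately show ?thesis by simp
  qed
  {
    assume g: "1 \<le> ga" "1 \<le> gb" "\<not> (1 \<le> g \<and> r \<le> ra + rb)"
    then have "(ra + rb, (ga - 1) + (gb - 1) + d) \<in> shifted_sums d A B"
      using A B by (intro shifted_sumsI) (auto simp: represents_def)
    moreover have "ga + (gb - 1) + d - 1 = (ga - 1) + (gb - 1) + d" using g by simp
    moreover have "ra + rb \<le> fst q" if "q \<in> C" for q
      using that C g(3) by (cases "g = 0") (auto simp: represents_def)
    ultimately show "represents (C \<union> shifted_sums d A B) (ra + rb) (ga + (gb - 1) + d)"
      using g le unfolding represents_def by auto
  next
    assume "\<not> (1 \<le> ga \<and> 1 \<le> gb \<and> \<not> (1 \<le> g \<and> r \<le> ra + rb))"
    then consider "ga = 0 \<or> gb = 0" | "1 \<le> g" "r \<le> ra + rb" by linarith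
    then show "represents (C \<union> shifted_sums d A B) r g"
    proof cases
      case 1
      then have "shifted_sums d A B = {}" using A B by (auto simp: represents_def shifted_sums_def)
      then show ?thesis using C by simp
    next
      case 2
      then show ?thesis using C le unfolding represents_def by fastforce
    qed
  }
qed

definition holds :: "state \<Rightarrow> (real \<times> nat) set \<Rightarrow> nat \<Rightarrow> nat \<Rightarrow> bool" where
  "holds \<sigma> C s i \<longleftrightarrow> represents C (snd \<sigma> (tab s) i) (fst \<sigma> (tab s) i)"

definition same_entry :: "state \<Rightarrow> state \<Rightarrow> nat \<Rightarrow> bool" where
  "same_entry \<sigma> \<sigma>' i \<longleftrightarrow> (\<forall>s. snd \<sigma>' (tab s) i = snd \<sigma> (tab s) i \<and> fst \<sigma>' (tab s) i = fst \<sigma> (tab s) i)"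

lemma holds_same_entry: "same_entry \<sigma> \<sigma>' i \<Longrightarrow> holds \<sigma>' C s i \<longleftrightarrow> holds \<sigma> C s i"
  by (simp add: holds_def same_entry_def)

lemma same_entry_trans: "same_entry \<sigma> \<sigma>' i \<Longrightarrow> same_entry \<sigma>' \<sigma>'' i \<Longrightarrow> same_entry \<sigma> \<sigma>'' i"
  by (simp add: same_entry_def)

lemma same_entry_refl: "same_entry \<sigma> \<sigma> i"
  by (simp add: same_entry_def)

lemma store_apply: "store a i v M b j = (if b = a \<and> j = i then v else M b j)"
  by (simp add: store_def)

lemma store_tab [simp]:
  "a = [] \<or> hd a \<noteq> CHR ''t'' \<Longrightarrow> store a i v M (tab s) = M (tab s)"
  using tab_neq[of a s] by (auto simp: store_def)

lemma holds_store [simp]: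
  "a = [] \<or> hd a \<noteq> CHR ''t'' \<Longrightarrow> holds (store a j v M, R) C s i = holds (M, R) C s i"
  by (simp add: holds_def)

lemma same_entry_store [simp]:
  "a = [] \<or> hd a \<noteq> CHR ''t'' \<Longrightarrow> same_entry \<sigma> (store a j v M, R) i = same_entry \<sigma> (M, R) i"
  "a = [] \<or> hd a \<noteq> CHR ''t'' \<Longrightarrow> same_entry (store a j v M, R) \<sigma> i = same_entry (M, R) \<sigma> i"
  by (simp_all add: same_entry_def)

section \<open>Updating one table entry by the state rules\<close>

fun rule_update :: "nat \<times> nat \<times> nat \<Rightarrow> com" where
  "rule_update (s, t, s') =
     Cond (BAnd (NLe (NConst 1) (NLoad (tab s) (var ''x'')))
         (BAnd (NLe (NConst 1) (NLoad (tab t) (var ''y'')))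
           (BNot (BAnd (NLe (NConst 1) (NLoad (tab s') (var ''z'')))
             (RLe (RLoad (tab s') (var ''z''))
               (RAdd (RLoad (tab s) (var ''x'')) (RLoad (tab t) (var ''y''))))))))
       (Seq
         (RStore (tab s') (var ''z'')
           (RAdd (RLoad (tab s) (var ''x'')) (RLoad (tab t) (var ''y''))))
         (NStore (tab s') (var ''z'')
           (NAdd (NAdd (NLoad (tab s) (var ''x'')) (NSub (NLoad (tab t) (var ''y'')) (NConst 1)))
             (var ''d''))))
       Skip"

fun updates :: "(nat \<times> nat \<times> nat) list \<Rightarrow> com" where
  "updates [] = Skip"
| "updates (r # rs) = Seq (rule_update r) (updates rs)"

lemma writes_updates: "nat_writes (updates rs) \<subseteq> range tab" "real_writes (updates rs) \<subseteq> range tab"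
  by (induction rs) auto

lemma notin_writes_updates [simp]:
  assumes "a = [] \<or> hd a \<noteq> CHR ''t''"
  shows "a \<notin> nat_writes (updates rs)" "a \<notin> real_writes (updates rs)"
  using writes_updates[of rs] tab_neq[OF assms] by auto

lemma runs_rule_update:
  assumes x: "fst \<sigma> ''x'' 0 = x" and y: "fst \<sigma> ''y'' 0 = y" and z: "fst \<sigma> ''z'' 0 = z"
    and d: "fst \<sigma> ''d'' 0 = d" and "x \<noteq> z" "y \<noteq> z"
    and A: "holds \<sigma> A s x" and B: "holds \<sigma> B t y" and C: "holds \<sigma> C s' z"
  shows "runs Z (rule_update (s, t, s')) \<sigma> (\<lambda>\<sigma>'. holds \<sigma>' (C \<union> shifted_sums d A B) s' z \<and>
    (\<forall>i. i \<noteq> z \<longrightarrow> same_entry \<sigma> \<sigma>' i) \<and> (\<forall>u. u \<noteq> s' \<longrightarrow> (\<forall>X i. holds \<sigma>' X u i = holds \<sigma> X u i)))"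
  unfolding rule_update.simps
proof (rule runs_cond, goal_cases)
  case 1
  then have "represents (C \<union> shifted_sums d A B) (snd \<sigma> (tab s) x + snd \<sigma> (tab t) y)
      (fst \<sigma> (tab s) x + (fst \<sigma> (tab t) y - 1) + d)"
    using assms by (intro represents_update(1)) (auto simp: holds_def)
  then show ?case
    using assms by (intro runs_seq runs_rstore runs_nstore) (simp add: holds_def same_entry_def store_apply)
next
  case 2
  then have "represents (C \<union> shifted_sums d A B) (snd \<sigma> (tab s') z) (fst \<sigma> (tab s') z)"
    using A B C by (intro represents_update(2)) (auto simp: holds_def x y z)
  then show ?case by (intro runs_skip) (simp add: holds_def same_entry_def)
qed

text \<open>Only cell \<open>z\<close> is written, and \<open>x\<close> and \<open>y\<close> differ
  from it, so the operands stay valid while the contents of \<open>z\<close> accumulate rule by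
  rule.\<close>

lemma runs_updates:
  assumes "fst \<sigma> ''x'' 0 = x" "fst \<sigma> ''y'' 0 = y" "fst \<sigma> ''z'' 0 = z" "fst \<sigma> ''d'' 0 = d"
    and "x \<noteq> z" "y \<noteq> z"
    and "\<And>s. s < 3 \<Longrightarrow> holds \<sigma> (A s) s x" "\<And>s. s < 3 \<Longrightarrow> holds \<sigma> (B s) s y"
      "\<And>s. s < 3 \<Longrightarrow> holds \<sigma> (C s) s z"
    and "\<And>s t s'. (s, t, s') \<in> set rs \<Longrightarrow> s < 3 \<and> t < 3 \<and> s' < 3"
  shows "runs Z (updates rs) \<sigma> (\<lambda>\<sigma>'. (\<forall>s<3. holds \<sigma>' (C s \<union> apply_rules rs d A B s) s z) \<and>
    (\<forall>i. i \<noteq> z \<longrightarrow> same_entry \<sigma> \<sigma>' i))"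
  using assms
proof (induction rs arbitrary: \<sigma> C)
  case Nil
  then show ?case by (auto simp: apply_rules_def same_entry_refl intro: runs_skip)
next
  case (Cons r rs)
  obtain s t s' where r: "r = (s, t, s')" by (cases r)
  then have lt: "s < 3" "t < 3" "s' < 3" using Cons.prems(10)[of s t s'] by auto
  define C' where "C' = C(s' := C s' \<union> shifted_sums d (A s) (B t))"
  have "runs Z (rule_update r) \<sigma> (\<lambda>\<sigma>'. (\<forall>u<3. holds \<sigma>' (C' u) u z) \<and> (\<forall>i. i \<noteq> z \<longrightarrow> same_entry \<sigma> \<sigma>' i))"
    unfolding r
    by (rule runs_conseq[OF runs_rule_update[OF Cons.prems(1-6) Cons.prems(7)[OF lt(1)]
      Cons.prems(8)[OF lt(2)] Cons.prems(9)[OF lt(3)]]]) (use Cons.prems(9) in \<open>auto simp: C'_def\<close>)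
  then show ?case
    unfolding updates.simps
  proof (rule runs_seq_frame)
    fix \<sigma>' assume h: "(\<forall>u<3. holds \<sigma>' (C' u) u z) \<and> (\<forall>i. i \<noteq> z \<longrightarrow> same_entry \<sigma> \<sigma>' i)"
      and "frame (rule_update r) \<sigma> \<sigma>'"
    then have "frame (updates [r]) \<sigma> \<sigma>'" by (auto intro: frame_mono)
    note sm = frame_nat[OF this notin_writes_updates(1)]
    have "runs Z (updates rs) \<sigma>' (\<lambda>\<tau>. (\<forall>s<3. holds \<tau> (C' s \<union> apply_rules rs d A B s) s z) \<and>
        (\<forall>i. i \<noteq> z \<longrightarrow> same_entry \<sigma>' \<tau> i))"
    proof (rule Cons.IH)
      show "s < 3 \<and> t < 3 \<and> s' < 3" if "(s, t, s') \<in> set rs" for s t s'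
        using that Cons.prems(10)[of s t s'] by simp
      show "holds \<sigma>' (A s) s x" "holds \<sigma>' (B s) s y" if "s < 3" for s
        using that h Cons.prems(5-8) holds_same_entry by blast+
    qed (use h Cons.prems(1-6) in \<open>simp_all add: sm\<close>)
    then show "runs Z (updates rs) \<sigma>' (\<lambda>\<tau>. (\<forall>s<3. holds \<tau> (C s \<union> apply_rules (r # rs) d A B s) s z) \<and>
        (\<forall>i. i \<noteq> z \<longrightarrow> same_entry \<sigma> \<tau> i))"
    proof (rule runs_conseq)
      fix \<tau> assume t: "(\<forall>s<3. holds \<tau> (C' s \<union> apply_rules rs d A B s) s z) \<and>
        (\<forall>i. i \<noteq> z \<longrightarrow> same_entry \<sigma>' \<tau> i)"
      have "C' u \<union> apply_rules rs d A B u = C u \<union> apply_rules (r # rs) d A B u" for u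
        by (auto simp: C'_def apply_rules_def r)
      then show "(\<forall>s<3. holds \<tau> (C s \<union> apply_rules (r # rs) d A B s) s z) \<and>
        (\<forall>i. i \<noteq> z \<longrightarrow> same_entry \<sigma> \<tau> i)"
        using t h same_entry_trans by metis
    qed
  qed
qed

text \<open>Here \<open>u\<close> is the parent's share of \<open>w\<close>. The truncated
  subtraction of \<open>ce\<close> is exact, because its guard ensures that the child's share
  \<open>w - u\<close> can pay for the edge.\<close>

definition split_step :: com where
  "split_step =
     Seq (assign ''x'' (NAdd (var ''bp'') (var ''u'')))
    (Seq (assign ''y'' (NAdd (var ''bc'') (NSub (var ''w'') (var ''u''))))
    (Seq (assign ''d'' (NConst 0))
    (Seq (updates keep_rules)
    (Cond (NLe (NAdd (var ''ce'') (var ''u'')) (var ''w''))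
      (Seq (assign ''y'' (NSub (var ''y'') (var ''ce'')))
      (Seq (assign ''d'' (var ''pe'')) (updates cut_rules)))
      Skip))))"

definition merge_table :: com where
  "merge_table = for_loop ''w'' (var ''W1'')
     (Seq (assign ''z'' (NAdd (var ''fp'') (var ''w'')))
       (for_loop ''u'' (NAdd (var ''w'') (NConst 1)) split_step))"

lemma writes_split_step: "nat_writes split_step \<subseteq> insert ''x'' (insert ''y'' (insert ''d'' (range tab)))"
  "real_writes split_step \<subseteq> range tab"
  using writes_updates[of keep_rules] writes_updates[of cut_rules] unfolding split_step_def by auto

lemma notin_writes_split_step [simp]:
  "a \<noteq> [] \<Longrightarrow> hd a \<noteq> CHR ''t'' \<Longrightarrow> a \<noteq> ''x'' \<Longrightarrow> a \<noteq> ''y'' \<Longrightarrow> a \<noteq> ''d'' \<Longrightarrow> a \<notin> nat_writes split_step"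
  "a \<noteq> [] \<Longrightarrow> hd a \<noteq> CHR ''t'' \<Longrightarrow> a \<notin> real_writes split_step"
  using writes_split_step tab_neq[of a] by auto

text \<open>One term of the union in \<open>candidates_merge\<close>, detached from graphs so that
  the table program can be verified for arbitrary families of sets.\<close>

definition split_set :: "nat \<Rightarrow> nat \<Rightarrow> (nat \<Rightarrow> nat \<Rightarrow> (real \<times> nat) set) \<Rightarrow>
    (nat \<Rightarrow> nat \<Rightarrow> (real \<times> nat) set) \<Rightarrow> nat \<Rightarrow> nat \<Rightarrow> nat \<Rightarrow> (real \<times> nat) set" where
  "split_set ce pe A B w u s = apply_rules keep_rules 0 (A u) (B (w - u)) s \<union>
     (if ce + u \<le> w then apply_rules cut_rules pe (A u) (B (w - u - ce)) s else {})"

lemma runs_split_step: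
  assumes v: "fst \<sigma> ''bp'' 0 = bp" "fst \<sigma> ''bc'' 0 = bc" "fst \<sigma> ''ce'' 0 = ce" "fst \<sigma> ''pe'' 0 = pe"
      "fst \<sigma> ''u'' 0 = u" "fst \<sigma> ''w'' 0 = w" "fst \<sigma> ''z'' 0 = z"
    and le: "u \<le> w" "w \<le> W" "bp + W < z" "bc + W < z"
    and A: "\<And>s w. s < 3 \<Longrightarrow> w \<le> W \<Longrightarrow> holds \<sigma> (A w s) s (bp + w)"
    and B: "\<And>s w. s < 3 \<Longrightarrow> w \<le> W \<Longrightarrow> holds \<sigma> (B w s) s (bc + w)"
    and C: "\<And>s. s < 3 \<Longrightarrow> holds \<sigma> (C s) s z"
  shows "runs Z split_step \<sigma> (\<lambda>\<sigma>'. (\<forall>s<3. holds \<sigma>' (C s \<union> split_set ce pe A B w u s) s z) \<and>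
    (\<forall>i. i \<noteq> z \<longrightarrow> same_entry \<sigma> \<sigma>' i))"
proof -
  define \<tau> where "\<tau> = (store ''d'' 0 0 (store ''y'' 0 (bc + (w - u)) (store ''x'' 0 (bp + u) (fst \<sigma>))), snd \<sigma>)"
  have \<tau>: "holds \<tau> X s i = holds \<sigma> X s i" "same_entry \<sigma> \<tau> i" for X s i
    by (simp_all add: \<tau>_def same_entry_def holds_def)
  let ?K = "\<lambda>s. C s \<union> apply_rules keep_rules 0 (A u) (B (w - u)) s"
  have keep: "runs Z (updates keep_rules) \<tau> (\<lambda>\<tau>'. (\<forall>s<3. holds \<tau>' (?K s) s z) \<and>
      (\<forall>i. i \<noteq> z \<longrightarrow> same_entry \<tau> \<tau>' i))"
  proof (rule runs_updates[where x = "bp + u" and y = "bc + (w - u)"])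
    show "s < 3 \<and> t < 3 \<and> s' < 3" if "(s, t, s') \<in> set keep_rules" for s t s'
      using that by (auto simp: keep_rules_def)
    show "holds \<tau> (B (w - u) s) s (bc + (w - u))" if "s < 3" for s
      unfolding \<tau> using that le by (intro B) auto
  qed (use le A C in \<open>simp_all add: \<tau>\<close>, simp_all add: \<tau>_def store_apply v)
  have "runs Z (Cond (NLe (NAdd (var ''ce'') (var ''u'')) (var ''w''))
      (Seq (assign ''y'' (NSub (var ''y'') (var ''ce'')))
      (Seq (assign ''d'' (var ''pe'')) (updates cut_rules)))
      Skip) \<tau>' (\<lambda>\<sigma>'. (\<forall>s<3. holds \<sigma>' (C s \<union> split_set ce pe A B w u s) s z) \<and>
         (\<forall>i. i \<noteq> z \<longrightarrow> same_entry \<sigma> \<sigma>' i))"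
    if h: "(\<forall>s<3. holds \<tau>' (?K s) s z) \<and> (\<forall>i. i \<noteq> z \<longrightarrow> same_entry \<tau> \<tau>' i)"
      and sm: "frame (updates keep_rules) \<tau> \<tau>'" for \<tau>'
  proof (rule runs_cond, goal_cases)
    note eq = frame_nat[OF sm notin_writes_updates(1)]
    case 1
    then have ce: "ce + u \<le> w" by (simp add: eq) (simp add: \<tau>_def store_apply v)
    define \<rho> where "\<rho> = (store ''d'' 0 pe (store ''y'' 0 (bc + (w - u - ce)) (fst \<tau>')), snd \<tau>')"
    have \<rho>: "holds \<rho> X s i = holds \<tau>' X s i" "same_entry \<tau>' \<rho> i" for X s i
      by (simp_all add: \<rho>_def same_entry_def holds_def)
    have old: "holds \<rho> X s i = holds \<sigma> X s i" if "i \<noteq> z" for X s i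
      using that h holds_same_entry[of \<tau> \<tau>' i X s] by (simp add: \<rho> \<tau>)
    have "runs Z (updates cut_rules) \<rho> (\<lambda>\<rho>'. (\<forall>s<3. holds \<rho>' (?K s \<union>
        apply_rules cut_rules pe (A u) (B (w - u - ce)) s) s z) \<and> (\<forall>i. i \<noteq> z \<longrightarrow> same_entry \<rho> \<rho>' i))"
    proof (rule runs_updates[where x = "bp + u" and y = "bc + (w - u - ce)"])
      show "holds \<rho> (A u s) s (bp + u)" if "s < 3" for s
        using that le A[of s u] old[of "bp + u"] by simp
      show "holds \<rho> (B (w - u - ce) s) s (bc + (w - u - ce))" if "s < 3" for s
      proof -
        have ne: "bc + (w - u - ce) \<noteq> z" using le by simp
        show ?thesis unfolding old[OF ne] using that le by (intro B) auto
      qed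
      show "holds \<rho> (?K s) s z" if "s < 3" for s using that h \<rho> by simp
      show "s < 3 \<and> t < 3 \<and> s' < 3" if "(s, t, s') \<in> set cut_rules" for s t s'
        using that by (auto simp: cut_rules_def)
    qed (use le in \<open>simp_all add: \<rho>_def store_apply eq\<close>, simp_all add: \<tau>_def store_apply v)
    then have "runs Z (updates cut_rules) \<rho> (\<lambda>\<sigma>'. (\<forall>s<3. holds \<sigma>' (C s \<union> split_set ce pe A B w u s) s z) \<and>
         (\<forall>i. i \<noteq> z \<longrightarrow> same_entry \<sigma> \<sigma>' i))"
    proof (rule runs_conseq, intro conjI)
      fix \<rho>' assume r: "(\<forall>s<3. holds \<rho>' (?K s \<union> apply_rules cut_rules pe (A u) (B (w - u - ce)) s) s z) \<and>
        (\<forall>i. i \<noteq> z \<longrightarrow> same_entry \<rho> \<rho>' i)"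
      then show "\<forall>s<3. holds \<rho>' (C s \<union> split_set ce pe A B w u s) s z"
        using ce by (simp add: split_set_def Un_assoc)
      show "\<forall>i. i \<noteq> z \<longrightarrow> same_entry \<sigma> \<rho>' i"
        using h r \<rho>(2) \<tau>(2) same_entry_trans by metis
    qed
    moreover have "\<rho> = (store ''d'' 0 (fst \<tau>' ''pe'' 0) (store ''y'' 0 (fst \<tau>' ''y'' 0 - fst \<tau>' ''ce'' 0) (fst \<tau>')), snd \<tau>')"
      using ce by (simp add: \<rho>_def eq) (simp add: \<tau>_def store_apply v)
    ultimately show ?case
      by (intro runs_seq runs_nstore) (simp add: store_apply)
  next
    note eq = frame_nat[OF sm notin_writes_updates(1)]
    case 2
    then have ce: "\<not> ce + u \<le> w" by (simp add: eq) (simp add: \<tau>_def store_apply v)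
    have "\<forall>i. i \<noteq> z \<longrightarrow> same_entry \<sigma> \<tau>' i" using h \<tau>(2) same_entry_trans by metis
    then show ?case using ce h by (intro runs_skip) (simp add: split_set_def)
  qed
  then have main: "runs Z (Seq (updates keep_rules) (Cond (NLe (NAdd (var ''ce'') (var ''u'')) (var ''w''))
      (Seq (assign ''y'' (NSub (var ''y'') (var ''ce'')))
      (Seq (assign ''d'' (var ''pe'')) (updates cut_rules)))
      Skip)) \<tau> (\<lambda>\<sigma>'. (\<forall>s<3. holds \<sigma>' (C s \<union> split_set ce pe A B w u s) s z) \<and>
         (\<forall>i. i \<noteq> z \<longrightarrow> same_entry \<sigma> \<sigma>' i))"
    using runs_seq_frame[OF keep] by blast
  show ?thesis
    unfolding split_step_def
    by (rule runs_seq, rule runs_nstore, rule runs_seq, rule runs_nstore, rule runs_seq, rule runs_nstore)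
      (use main in \<open>simp add: \<tau>_def store_apply v\<close>)
qed

text \<open>The target block starts at \<open>fp\<close>, above both source blocks, so the sources
  are undisturbed while it is filled. Its zero codes represent the empty union from which each inner
  loop starts, and the memory beyond stays zero for later merges.\<close>

lemma runs_merge_table:
  assumes v: "fst \<sigma> ''bp'' 0 = bp" "fst \<sigma> ''bc'' 0 = bc" "fst \<sigma> ''ce'' 0 = ce" "fst \<sigma> ''pe'' 0 = pe"
      "fst \<sigma> ''fp'' 0 = fp" "fst \<sigma> ''W1'' 0 = Suc W"
    and le: "bp + W < fp" "bc + W < fp" "W < Z"
    and A: "\<And>s w. s < 3 \<Longrightarrow> w \<le> W \<Longrightarrow> holds \<sigma> (A w s) s (bp + w)"
    and B: "\<And>s w. s < 3 \<Longrightarrow> w \<le> W \<Longrightarrow> holds \<sigma> (B w s) s (bc + w)"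
    and clean: "\<And>s i. s < 3 \<Longrightarrow> fp \<le> i \<Longrightarrow> fst \<sigma> (tab s) i = 0"
  shows "runs Z merge_table \<sigma> (\<lambda>\<sigma>'.
    (\<forall>w<Suc W. \<forall>s<3. holds \<sigma>' (\<Union>u<Suc w. split_set ce pe A B w u s) s (fp + w)) \<and>
    (\<forall>i<fp. same_entry \<sigma> \<sigma>' i) \<and> (\<forall>s<3. \<forall>i\<ge>fp + Suc W. fst \<sigma>' (tab s) i = 0))"
proof -
  define J where "J k \<sigma>' \<longleftrightarrow>
    (\<forall>w<k. \<forall>s<3. holds \<sigma>' (\<Union>u<Suc w. split_set ce pe A B w u s) s (fp + w)) \<and>
    (\<forall>i<fp. same_entry \<sigma> \<sigma>' i) \<and> (\<forall>s<3. \<forall>i\<ge>fp + k. fst \<sigma>' (tab s) i = 0)" for k \<sigma>'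
  have "runs Z merge_table \<sigma> (J (Suc W))"
    unfolding merge_table_def
  proof (rule runs_for_loop[where I = J and N = "Suc W"])
    fix k \<tau>
    assume k: "k < Suc W" and J: "J k \<tau>" and w: "fst \<tau> ''w'' 0 = k"
      and sm: "frame (for_loop ''w'' (var ''W1'') (Seq (assign ''z'' (NAdd (var ''fp'') (var ''w'')))
        (for_loop ''u'' (NAdd (var ''w'') (NConst 1)) split_step))) \<sigma> \<tau>"
    have vt: "fst \<tau> ''bp'' 0 = bp" "fst \<tau> ''bc'' 0 = bc" "fst \<tau> ''ce'' 0 = ce" "fst \<tau> ''pe'' 0 = pe"
      "fst \<tau> ''fp'' 0 = fp"
      using v by (simp_all add: frame_nat[OF sm])
    define \<rho> where "\<rho> = (store ''z'' 0 (fp + k) (fst \<tau>), snd \<tau>)"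
    have \<rho>: "holds \<rho> X s i = holds \<tau> X s i" "same_entry \<tau> \<rho> i" "fst \<rho> (tab s) = fst \<tau> (tab s)" for X s i
      by (simp_all add: \<rho>_def same_entry_def holds_def)
    let ?I = "\<lambda>l \<rho>'. (\<forall>s<3. holds \<rho>' (\<Union>u<l. split_set ce pe A B k u s) s (fp + k)) \<and>
      (\<forall>i. i \<noteq> fp + k \<longrightarrow> same_entry \<tau> \<rho>' i)"
    have "runs Z (for_loop ''u'' (NAdd (var ''w'') (NConst 1)) split_step) \<rho> (?I (Suc k))"
    proof (rule runs_for_loop[where I = ?I and N = "Suc k"])
      show "?I 0 \<rho>"
        using J by (auto simp: \<rho>) (simp add: holds_def represents_def J_def)
    next
      fix l \<rho>' assume l: "l < Suc k" and I: "?I l \<rho>'" and u: "fst \<rho>' ''u'' 0 = l"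
        and sm': "frame (for_loop ''u'' (NAdd (var ''w'') (NConst 1)) split_step) \<rho> \<rho>'"
      have old: "holds \<rho>' X s i = holds \<sigma> X s i" if "i < fp" for X s i
        using that I J unfolding J_def
        by (metis (no_types, lifting) holds_same_entry not_add_less1 same_entry_trans)
      have vr: "fst \<rho>' a = fst \<rho> a"
        if "a \<noteq> ''u''" "a \<noteq> []" "hd a \<noteq> CHR ''t''" "a \<noteq> ''x''" "a \<noteq> ''y''" "a \<noteq> ''d''" for a
        using frame_nat[OF sm', of a] that by simp
      have "runs Z split_step \<rho>' (\<lambda>\<rho>''. (\<forall>s<3. holds \<rho>'' ((\<Union>u<l. split_set ce pe A B k u s) \<union>
          split_set ce pe A B k l s) s (fp + k)) \<and> (\<forall>i. i \<noteq> fp + k \<longrightarrow> same_entry \<rho>' \<rho>'' i))"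
      proof (rule runs_split_step[where W = W and bp = bp and bc = bc])
        show "holds \<rho>' (A w s) s (bp + w)" if "s < 3" "w \<le> W" for s w
          using A[OF that] old[of "bp + w"] that le by simp
        show "holds \<rho>' (B w s) s (bc + w)" if "s < 3" "w \<le> W" for s w
          using B[OF that] old[of "bc + w"] that le by simp
      qed (use I l k le u in \<open>simp_all add: vr\<close>, simp_all add: \<rho>_def store_apply vt w)
      then show "runs Z split_step \<rho>' (?I (Suc l))"
      proof (rule runs_conseq)
        fix \<rho>'' assume r: "(\<forall>s<3. holds \<rho>'' ((\<Union>u<l. split_set ce pe A B k u s) \<union>
          split_set ce pe A B k l s) s (fp + k)) \<and> (\<forall>i. i \<noteq> fp + k \<longrightarrow> same_entry \<rho>' \<rho>'' i)"
        then have "\<forall>i. i \<noteq> fp + k \<longrightarrow> same_entry \<tau> \<rho>'' i" using I same_entry_trans by metis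
        then show "?I (Suc l) \<rho>''" using r by (simp add: lessThan_Suc Un_commute)
      qed
    next
      show "nval (NAdd (var ''w'') (NConst 1)) \<rho>' = Suc k"
        if "frame (for_loop ''u'' (NAdd (var ''w'') (NConst 1)) split_step) \<rho> \<rho>'" for \<rho>'
        by (simp add: frame_nat[OF that]) (simp add: \<rho>_def store_apply w)
    qed (use k le in simp_all)
    then have "runs Z (for_loop ''u'' (NAdd (var ''w'') (NConst 1)) split_step) \<rho> (J (Suc k))"
    proof (rule runs_conseq)
      fix \<rho>' assume I: "?I (Suc k) \<rho>'"
      show "J (Suc k) \<rho>'"
        unfolding J_def
      proof (intro conjI allI impI)
        fix w s :: nat assume ws: "w < Suc k" "s < 3"
        show "holds \<rho>' (\<Union>u<Suc w. split_set ce pe A B w u s) s (fp + w)"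
        proof (cases "w = k")
          case True
          then show ?thesis using I ws by simp
        next
          case False
          then have "w < k" "same_entry \<tau> \<rho>' (fp + w)" using ws I by auto
          then show ?thesis using J ws unfolding J_def by (simp add: holds_same_entry)
        qed
      next
        fix i assume "i < fp"
        then have "same_entry \<sigma> \<tau> i" "same_entry \<tau> \<rho>' i" using J I unfolding J_def by auto
        then show "same_entry \<sigma> \<rho>' i" by (rule same_entry_trans)
      next
        fix s i :: nat assume "s < 3" "fp + Suc k \<le> i"
        then have "fst \<tau> (tab s) i = 0" "same_entry \<tau> \<rho>' i" using J I unfolding J_def by auto
        then show "fst \<rho>' (tab s) i = 0" by (simp add: same_entry_def)
      qed
    qed
    then show "runs Z (Seq (assign ''z'' (NAdd (var ''fp'') (var ''w'')))
        (for_loop ''u'' (NAdd (var ''w'') (NConst 1)) split_step)) \<tau> (J (Suc k))"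
      by (intro runs_seq runs_nstore) (simp add: \<rho>_def vt w)
  next
    show "nval (var ''W1'') \<tau> = Suc W" if "frame (for_loop ''w'' (var ''W1'')
        (Seq (assign ''z'' (NAdd (var ''fp'') (var ''w'')))
        (for_loop ''u'' (NAdd (var ''w'') (NConst 1)) split_step))) \<sigma> \<tau>" for \<tau>
      using v by (simp add: frame_nat[OF that])
  qed (use le clean in \<open>simp_all add: J_def same_entry_refl\<close>)
  then show ?thesis unfolding J_def .
qed

section \<open>The program\<close>

abbreviation one :: nexp where "one \<equiv> NConst 1"

text \<open>A floor has to be found by comparisons, so \<open>W\<close> and its real copy
  \<open>wr\<close> are incremented together until the sum of costs or the budget stops them.
  Stopping at the smaller of the two keeps a huge budget from costing time.\<close>

definition budget_phase :: com where
  "budget_phase =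
     Seq (for_loop ''i'' (var ''m'') (assign ''sum'' (NAdd (var ''sum'') (NLoad ''cost'' (var ''i'')))))
    (Seq (While (BAnd (nless (var ''W'') (var ''sum''))
           (RLe (RAdd (RLoad ''wr'' (NConst 0)) (RConst 1)) (RLoad ''budget'' (NConst 0))))
         (Seq (assign ''W'' (NAdd (var ''W'') one))
              (RStore ''wr'' (NConst 0) (RAdd (RLoad ''wr'' (NConst 0)) (RConst 1)))))
       (assign ''W1'' (NAdd (var ''W'') one)))"

definition power_phase :: com where
  "power_phase = Seq (assign ''pw'' one) (for_loop ''i'' (var ''m'')
     (NStore ''pw'' (NAdd (var ''i'') one) (NAdd (NLoad ''pw'' (var ''i'')) (NLoad ''pw'' (var ''i'')))))"

text \<open>An ignited vertex admits only state 1; any other admits states 0 and 2, with risk 0 and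
  its value respectively. The stored 1 is the shifted code of the empty cut.\<close>

definition init_entry :: com where
  "init_entry = (let z = NAdd (var ''fp'') (var ''w'') in
     Cond (RLe (RLoad ''ignition'' (var ''v'')) (RConst 0))
       (Seq (RStore (tab 0) z (RConst 0)) (Seq (NStore (tab 0) z one)
         (Seq (RStore (tab 2) z (RLoad ''value'' (var ''v''))) (NStore (tab 2) z one))))
       (Seq (RStore (tab 1) z (RLoad ''value'' (var ''v''))) (NStore (tab 1) z one)))"

definition init_phase :: com where
  "init_phase = for_loop ''v'' (var ''n'')
     (Seq (NStore ''cur'' (var ''v'') (var ''fp''))
     (Seq (for_loop ''w'' (var ''W1'') init_entry)
       (assign ''fp'' (NAdd (var ''fp'') (var ''W1'')))))"

text \<open>Marks are 0 or 1, so unequal marks reveal an edge leaving the visited set. There is no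
  early exit: later hits overwrite earlier ones.\<close>

definition search :: com where
  "search = for_loop ''i'' (var ''m'')
     (let a = NLoad ''vis'' (NLoad ''src'' (var ''i'')); b = NLoad ''vis'' (NLoad ''dst'' (var ''i''))
      in Cond (BAnd (NLe a b) (NLe b a)) Skip (assign ''sel'' (var ''i'')))"

definition order_phase :: com where
  "order_phase =
     Seq (assign ''vis'' one)
    (Seq (assign ''N'' (NSub (var ''n'') one))
    (for_loop ''k'' (var ''N'')
      (Seq search
      (Seq (assign ''a'' (NLoad ''src'' (var ''sel'')))
      (Seq (assign ''b'' (NLoad ''dst'' (var ''sel'')))
      (Seq (Cond (NLe one (NLoad ''vis'' (var ''a'')))
             (Seq (NStore ''par'' (var ''k'') (var ''a'')) (NStore ''chi'' (var ''k'') (var ''b'')))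
             (Seq (NStore ''par'' (var ''k'') (var ''b'')) (NStore ''chi'' (var ''k'') (var ''a''))))
      (Seq (NStore ''eid'' (var ''k'') (var ''sel''))
        (NStore ''vis'' (NLoad ''chi'' (var ''k'')) one))))))))"

text \<open>In reverse order all edges below a child come before the edge to its parent, so the
  child's table is complete when it is merged. \<open>cur\<close> holds the start address of the
  current table of each root.\<close>

definition merge_phase :: com where
  "merge_phase = for_loop ''k'' (var ''N'')
     (Seq (assign ''j'' (NSub (NSub (var ''N'') one) (var ''k'')))
     (Seq (assign ''p'' (NLoad ''par'' (var ''j'')))
     (Seq (assign ''bp'' (NLoad ''cur'' (var ''p'')))
     (Seq (assign ''bc'' (NLoad ''cur'' (NLoad ''chi'' (var ''j''))))
     (Seq (assign ''ce'' (NLoad ''cost'' (NLoad ''eid'' (var ''j''))))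
     (Seq (assign ''pe'' (NLoad ''pw'' (NLoad ''eid'' (var ''j''))))
     (Seq merge_table
     (Seq (NStore ''cur'' (var ''p'') (var ''fp''))
       (assign ''fp'' (NAdd (var ''fp'') (var ''W1'')))))))))))"

text \<open>No merge follows at the root, so an open promise can no longer be fulfilled and state 2
  is left out of the comparison.\<close>

definition select_phase :: com where
  "select_phase =
     Seq (assign ''x'' (NAdd (var ''cur'') (var ''W'')))
       (Cond (BAnd (NLe one (NLoad (tab 0) (var ''x'')))
          (BNot (BAnd (NLe one (NLoad (tab 1) (var ''x'')))
             (RLe (RLoad (tab 1) (var ''x'')) (RLoad (tab 0) (var ''x''))))))
         (assign ''msk'' (NSub (NLoad (tab 0) (var ''x'')) one))
         (assign ''msk'' (NSub (NLoad (tab 1) (var ''x'')) one)))"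

definition decode_phase :: com where
  "decode_phase = for_loop ''k'' (var ''m'')
     (Seq (assign ''j'' (NSub (NSub (var ''m'') one) (var ''k'')))
       (Cond (NLe (NLoad ''pw'' (var ''j'')) (var ''msk''))
         (Seq (NStore ''cut'' (var ''j'') one) (assign ''msk'' (NSub (var ''msk'') (NLoad ''pw'' (var ''j'')))))
         Skip))"

definition program :: com where
  "program = Seq budget_phase (Seq power_phase (Seq init_phase (Seq order_phase
     (Seq merge_phase (Seq select_phase decode_phase)))))"

text \<open>The powers below \<open>2 ^ j\<close> add up to \<open>2 ^ j - 1\<close>, so one
  comparison reads off the highest index.\<close>

lemma sum_powers_decode:
  fixes J :: "nat set"
  assumes "J \<subseteq> {..<Suc j}"
  shows "2 ^ j \<le> (\<Sum>i\<in>J. 2 ^ i :: nat) \<longleftrightarrow> j \<in> J"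
proof
  have fin: "finite J" using assms finite_subset by blast
  show "2 ^ j \<le> (\<Sum>i\<in>J. 2 ^ i :: nat)" if "j \<in> J"
    using member_le_sum[OF that, of "\<lambda>i. 2 ^ i :: nat"] fin by simp
  show "j \<in> J" if h: "2 ^ j \<le> (\<Sum>i\<in>J. 2 ^ i :: nat)"
  proof (rule ccontr)
    assume "j \<notin> J"
    then have "J \<subseteq> {..<j}" using assms by (auto simp: less_Suc_eq)
    then have "(\<Sum>i\<in>J. 2 ^ i :: nat) \<le> (\<Sum>i<j. 2 ^ i)" by (intro sum_mono2) auto
    also have "\<dots> < 2 ^ j" using mask_eq_sum_exp_nat[of j] by (simp add: lessThan_def flip: mask_eq_sum_exp_nat)
    finally show False using h by simp
  qed
qed

section \<open>Quantities of a fixed tree instance\<close>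

locale listed_tree =
  fixes I :: wfl and es :: "(nat \<times> nat) list"
  assumes tree: "wfl_tree I" and listing: "edge_listing I es"
begin

abbreviation n where "n \<equiv> nverts I"
abbreviation m where "m \<equiv> length es"
abbreviation V where "V \<equiv> verts I"
abbreviation E where "E \<equiv> edges I"

definition ed :: "nat \<Rightarrow> nat set" where
  "ed i = {fst (es ! i), snd (es ! i)}"

text \<open>\<open>inv_into\<close> recovers the position in the listing, which gives each edge its
  own bit.\<close>

definition code :: "nat set \<Rightarrow> nat" where
  "code e = 2 ^ inv_into {..<m} ed e"

sublocale firebreak "vertex_value I" "{v. ignition I v = 1}" "cost I" code .

definition W :: nat where
  "W = min (\<Sum>e\<in>E. cost I e) (nat \<lfloor>budget I\<rfloor>)"

text \<open>Large enough for every loop: the counts that occur are \<open>m\<close>,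
  \<open>n\<close>, \<open>n - 1\<close>, \<open>W\<close> and at most \<open>W + 1\<close>.\<close>

definition Z :: nat where
  "Z = n + m + W + 2"

lemma tree_facts: "tree_graph V E" "\<And>v. v < n \<Longrightarrow> ignition I v = 0 \<or> ignition I v = 1" "budget I \<ge> 0"
  using tree by (auto simp: wfl_tree_def)

lemma edgeD: assumes "e \<in> E" shows "e \<subseteq> V" "card e = 2"
  using tree_facts(1) assms by (auto simp: tree_graph_def simple_graph_def)

lemma n_pos: "0 < n"
  using tree_facts(1) by (auto simp: tree_graph_def connected_graph_def)

lemma ed_bij: "bij_betw ed {..<m} E"
proof -
  let ?ls = "map (\<lambda>(u, v). {u, v}) es"
  have "distinct ?ls" "set ?ls = E" using listing by (simp_all add: edge_listing_def Let_def)
  then have "bij_betw ((!) ?ls) {..<m} E" by (intro bij_betw_nth) auto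
  then show ?thesis by (rule bij_betw_cong[THEN iffD1, rotated]) (simp add: ed_def case_prod_beta)
qed

lemma ed_mem: "i < m \<Longrightarrow> ed i \<in> E"
  using ed_bij bij_betwE by blast

lemma ed_surj: "e \<in> E \<Longrightarrow> \<exists>i<m. ed i = e"
  using ed_bij by (metis bij_betw_def imageE lessThan_iff)

lemma finite_E: "finite E"
  using ed_bij bij_betw_finite by blast

lemma code_ed: "i < m \<Longrightarrow> code (ed i) = 2 ^ i"
  using ed_bij by (simp add: code_def bij_betw_def inv_into_f_f)

lemma image_ed: "H \<subseteq> E \<Longrightarrow> ed ` {i. i < m \<and> ed i \<in> H} = H"
  using ed_surj by blast

lemma sum_code:
  assumes "H \<subseteq> E"
  shows "sum code H = (\<Sum>i | i < m \<and> ed i \<in> H. 2 ^ i)"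
proof -
  have "inj_on ed {i. i < m \<and> ed i \<in> H}"
    using ed_bij by (auto simp: bij_betw_def intro: inj_on_subset)
  then have "sum code H = (\<Sum>i | i < m \<and> ed i \<in> H. code (ed i))"
    using image_ed[OF assms] by (metis (no_types, lifting) sum.reindex_cong)
  then show ?thesis by (simp add: code_ed)
qed

text \<open>Costs are natural numbers, so rounding the budget down loses nothing, and no cut system
  costs more than all edges together.\<close>

lemma feasible_iff: "feasible I H \<longleftrightarrow> H \<subseteq> E \<and> sum (cost I) H \<le> W"
proof -
  have "real k \<le> budget I \<longleftrightarrow> k \<le> nat \<lfloor>budget I\<rfloor>" for k
    using tree_facts(3) by (simp add: le_nat_iff le_floor_iff)
  moreover have "sum (cost I) H \<le> sum (cost I) E" if "H \<subseteq> E"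
    using that finite_E by (intro sum_mono2) auto
  ultimately show ?thesis unfolding feasible_def W_def by (auto simp del: of_nat_sum)
qed

text \<open>With probabilities 0 and 1 the product has a factor 0 as soon as the component contains
  an ignition, and only factors 1 otherwise.\<close>

lemma wfl_risk_eq: "wfl_risk I H = (\<Sum>x\<in>V. vertex_value I x * of_bool (burns V (E - H) x))"
proof -
  have "1 - (\<Prod>t\<in>component V (E - H) x. 1 - ignition I t) = of_bool (burns V (E - H) x)" for x
  proof (cases "burns V (E - H) x")
    case True
    then obtain t where "t \<in> component V (E - H) x" "ignition I t = 1" by (auto simp: burns_def)
    moreover have "finite (component V (E - H) x)" by (simp add: component_def)
    ultimately have "(\<Prod>t\<in>component V (E - H) x. 1 - ignition I t) = 0"
      by (intro prod_zero) auto
    then show ?thesis using True by simp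
  next
    case False
    have "(\<Prod>t\<in>component V (E - H) x. 1 - ignition I t) = 1"
    proof (rule prod.neutral, rule ballI)
      fix t assume t: "t \<in> component V (E - H) x"
      then have "t < n" by (simp add: component_def)
      then show "1 - ignition I t = 1" using False t tree_facts(2)[of t] by (auto simp: burns_def)
    qed
    then show ?thesis using False by simp
  qed
  then show ?thesis by (simp add: wfl_risk_def risk_def)
qed

text \<open>The part of memory that no phase writes. Zeros in working arrays do not last, so they
  are assumed separately where they matter.\<close>

definition input :: "state \<Rightarrow> bool" where
  "input \<sigma> \<longleftrightarrow> fst \<sigma> ''n'' 0 = n \<and> fst \<sigma> ''m'' 0 = m \<and>
     (\<forall>i<m. fst \<sigma> ''src'' i = fst (es ! i) \<and> fst \<sigma> ''dst'' i = snd (es ! i) \<and>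
        fst \<sigma> ''cost'' i = cost I (ed i)) \<and>
     (\<forall>v<n. snd \<sigma> ''value'' v = vertex_value I v \<and> snd \<sigma> ''ignition'' v = ignition I v) \<and>
     snd \<sigma> ''budget'' 0 = budget I"

lemma input_frame:
  assumes "input \<sigma>" "frame c \<sigma> \<sigma>'" "nat_writes c \<inter> {''n'', ''m'', ''src'', ''dst'', ''cost''} = {}"
    "real_writes c \<inter> {''value'', ''ignition'', ''budget''} = {}"
  shows "input \<sigma>'"
proof -
  have "fst \<sigma>' a = fst \<sigma> a" if "a \<in> {''n'', ''m'', ''src'', ''dst'', ''cost''}" for a
    using assms(2,3) that by (intro frame_nat) blast+
  moreover have "snd \<sigma>' a = snd \<sigma> a" if "a \<in> {''value'', ''ignition'', ''budget''}" for a
    using assms(2,4) that by (intro frame_real) blast+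
  ultimately show ?thesis using assms(1) by (simp add: input_def)
qed

section \<open>Computing the budget limit and the powers of two\<close>

lemma runs_budget_phase:
  assumes inp: "input \<sigma>" and zero: "fst \<sigma> ''sum'' 0 = 0" "fst \<sigma> ''W'' 0 = 0" "snd \<sigma> ''wr'' 0 = 0"
  shows "runs Z budget_phase \<sigma> (\<lambda>\<sigma>'. fst \<sigma>' ''W'' 0 = W \<and> fst \<sigma>' ''W1'' 0 = Suc W)"
  unfolding budget_phase_def
proof (rule runs_seq_frame[where P = "\<lambda>\<tau>. fst \<tau> ''sum'' 0 = (\<Sum>e\<in>E. cost I e)"])
  let ?I = "\<lambda>k \<tau>. fst \<tau> ''sum'' 0 = (\<Sum>i<k. cost I (ed i))"
  show "runs Z (for_loop ''i'' (var ''m'') (assign ''sum'' (NAdd (var ''sum'') (NLoad ''cost'' (var ''i'')))))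
      \<sigma> (\<lambda>\<tau>. fst \<tau> ''sum'' 0 = (\<Sum>e\<in>E. cost I e))" (is "runs Z ?c _ _")
  proof (rule runs_for_loop[where I = ?I and N = m])
    fix k \<tau> assume h: "k < m" "?I k \<tau>" "frame ?c \<sigma> \<tau>" "fst \<tau> ''i'' 0 = k"
    then have "input \<tau>" using inp by (intro input_frame[OF inp h(3)]) auto
    then show "runs Z (assign ''sum'' (NAdd (var ''sum'') (NLoad ''cost'' (var ''i'')))) \<tau> (?I (Suc k))"
      using h by (intro runs_nstore) (simp add: store_apply input_def)
  next
    fix \<tau> assume "?I m \<tau>"
    then show "fst \<tau> ''sum'' 0 = (\<Sum>e\<in>E. cost I e)"
      using sum.reindex_bij_betw[OF ed_bij, of "cost I"] by simp
  qed (use inp zero in \<open>simp_all add: Z_def input_def store_apply frame_nat\<close>)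
next
  fix \<tau> assume sum: "fst \<tau> ''sum'' 0 = (\<Sum>e\<in>E. cost I e)"
    and sm: "frame (for_loop ''i'' (var ''m'') (assign ''sum'' (NAdd (var ''sum'') (NLoad ''cost'' (var ''i''))))) \<sigma> \<tau>"
  let ?b = "BAnd (nless (var ''W'') (var ''sum''))
           (RLe (RAdd (RLoad ''wr'' (NConst 0)) (RConst 1)) (RLoad ''budget'' (NConst 0)))"
  let ?c = "Seq (assign ''W'' (NAdd (var ''W'') one))
              (RStore ''wr'' (NConst 0) (RAdd (RLoad ''wr'' (NConst 0)) (RConst 1)))"
  let ?I = "\<lambda>k \<rho>. fst \<rho> ''W'' 0 = k \<and> snd \<rho> ''wr'' 0 = real k"
  \<comment> \<open>The integer \<open>k + 1\<close> fits the budget iff it fits its floor; hence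
    the loop makes exactly \<open>W\<close> rounds.\<close>
  have bval: "bval ?b \<rho> \<longleftrightarrow> k < W" if "?I k \<rho>" "frame ?c \<tau> \<rho>" for k \<rho>
  proof -
    have "fst \<rho> ''sum'' 0 = (\<Sum>e\<in>E. cost I e)" "snd \<rho> ''budget'' 0 = budget I"
      using sum inp by (simp_all add: frame_nat[OF that(2)] frame_real[OF that(2)] frame_real[OF sm] input_def)
    moreover have "real k + 1 \<le> budget I \<longleftrightarrow> Suc k \<le> nat \<lfloor>budget I\<rfloor>"
      using tree_facts(3) by (simp add: le_nat_iff le_floor_iff add.commute)
    ultimately show ?thesis using that(1) by (auto simp: W_def)
  qed
  show "runs Z (Seq (While ?b ?c) (assign ''W1'' (NAdd (var ''W'') one))) \<tau>
      (\<lambda>\<sigma>'. fst \<sigma>' ''W'' 0 = W \<and> fst \<sigma>' ''W1'' 0 = Suc W)"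
  proof (rule runs_seq_frame[where P = "?I W"])
    show "runs Z (While ?b ?c) \<tau> (?I W)"
    proof (rule runs_while[where I = ?I and N = W])
      show "?I 0 \<tau>" using zero by (simp add: frame_nat[OF sm] frame_real[OF sm])
    next
      fix k \<rho> assume h: "k < W" "?I k \<rho>" "frame ?c \<tau> \<rho>"
      have "runs Z ?c \<rho> (?I (Suc k))"
        using h by (intro runs_seq runs_nstore runs_rstore) (simp add: store_apply)
      then show "bval ?b \<rho> \<and> runs Z ?c \<rho> (?I (Suc k))" using bval h by blast
    next
      fix \<rho> assume "?I W \<rho>" "frame ?c \<tau> \<rho>"
      then show "\<not> bval ?b \<rho>" using bval by blast
    qed (simp_all add: Z_def)
  qed (intro runs_nstore, simp add: store_apply)
qed

lemma runs_power_phase: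
  assumes inp: "input \<sigma>"
  shows "runs Z power_phase \<sigma> (\<lambda>\<sigma>'. \<forall>i\<le>m. fst \<sigma>' ''pw'' i = 2 ^ i)"
  unfolding power_phase_def
proof (rule runs_seq, rule runs_nstore)
  let ?\<tau> = "(store ''pw'' (nval (NConst 0) \<sigma>) (nval one \<sigma>) (fst \<sigma>), snd \<sigma>)"
  let ?I = "\<lambda>k (\<tau> :: state). \<forall>i\<le>k. fst \<tau> ''pw'' i = 2 ^ i"
  show "runs Z (for_loop ''i'' (var ''m'') (NStore ''pw'' (NAdd (var ''i'') one)
      (NAdd (NLoad ''pw'' (var ''i'')) (NLoad ''pw'' (var ''i''))))) ?\<tau> (?I m)"
  proof (rule runs_for_loop[where I = ?I and N = m])
    fix k \<tau> assume h: "?I k \<tau>" "fst \<tau> ''i'' 0 = k"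
    show "runs Z (NStore ''pw'' (NAdd (var ''i'') one)
        (NAdd (NLoad ''pw'' (var ''i'')) (NLoad ''pw'' (var ''i'')))) \<tau> (?I (Suc k))"
      using h by (intro runs_nstore) (auto simp: store_apply le_Suc_eq)
  qed (use inp in \<open>simp_all add: Z_def input_def store_apply frame_nat\<close>)
qed


section \<open>Tables of single vertices\<close>

lemma less_3_cases: "s < 3 \<Longrightarrow> s = 0 \<or> s = 1 \<or> s = (2::nat)"
  by linarith

text \<open>States that contradict the ignition are never written; their zero codes, ensured by the
  last assumption, correctly stand for the absence of candidates.\<close>

lemma runs_init_entry:
  assumes inp: "input \<sigma>" and v: "fst \<sigma> ''v'' 0 = v" "v < n"
    and z: "fst \<sigma> ''fp'' 0 + fst \<sigma> ''w'' 0 = z" and clean: "\<And>s. s < 3 \<Longrightarrow> fst \<sigma> (tab s) z = 0"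
  shows "runs Z init_entry \<sigma> (\<lambda>\<sigma>'. (\<forall>s<3. \<forall>w. holds \<sigma>' (candidates {v} {} v s w) s z) \<and>
    (\<forall>i. i \<noteq> z \<longrightarrow> same_entry \<sigma> \<sigma>' i))"
  unfolding init_entry_def Let_def
proof (rule runs_cond, goal_cases)
  have val: "snd \<sigma> ''value'' v = vertex_value I v" "snd \<sigma> ''ignition'' v = ignition I v"
    using inp v by (auto simp: input_def)
  {
    case 1
    then have ign: "ignition I v = 0" using v val tree_facts(2)[of v] by simp
    show ?case
      by (intro runs_seq runs_nstore runs_rstore)
        (use clean in \<open>auto simp: store_apply z v val ign holds_def same_entry_def candidates_singleton represents_def
          ignited_def promise_def dest!: less_3_cases\<close>)
  next
    case 2
    then have ign: "ignition I v = 1" using v val tree_facts(2)[of v] by simp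
    show ?case
      by (intro runs_seq runs_nstore runs_rstore)
        (use clean in \<open>auto simp: store_apply z v val ign holds_def same_entry_def candidates_singleton represents_def
          ignited_def promise_def dest!: less_3_cases\<close>)
  }
qed

definition clean :: "state \<Rightarrow> bool" where
  "clean \<sigma> \<longleftrightarrow> (\<forall>s<3. \<forall>i\<ge>fst \<sigma> ''fp'' 0. fst \<sigma> (tab s) i = 0)"

text \<open>\<open>K v\<close> and \<open>D v\<close> are the vertices and edges of the partial
  subtree rooted at \<open>v\<close>. They exist only in the proof; the program keeps just the start
  of a block of \<open>W + 1\<close> cells below the free pointer \<open>fp\<close>.\<close>

definition tables :: "state \<Rightarrow> (nat \<Rightarrow> nat set) \<Rightarrow> (nat \<Rightarrow> nat set set) \<Rightarrow> nat set \<Rightarrow> bool" where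
  "tables \<sigma> K D A \<longleftrightarrow> (\<forall>v\<in>A. fst \<sigma> ''cur'' v + W < fst \<sigma> ''fp'' 0 \<and>
     (\<forall>s<3. \<forall>w\<le>W. holds \<sigma> (candidates (K v) (D v) v s w) s (fst \<sigma> ''cur'' v + w)))"

lemma runs_init_phase:
  assumes inp: "input \<sigma>" and W1: "fst \<sigma> ''W1'' 0 = Suc W" and cl: "clean \<sigma>"
  shows "runs Z init_phase \<sigma> (\<lambda>\<sigma>'. tables \<sigma>' (\<lambda>v. {v}) (\<lambda>_. {}) {..<n} \<and> clean \<sigma>')"
  unfolding init_phase_def
proof (rule runs_for_loop[where N = n and I = "\<lambda>k \<sigma>'. tables \<sigma>' (\<lambda>v. {v}) (\<lambda>_. {}) {..<k} \<and> clean \<sigma>'"])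
  let ?body = "Seq (NStore ''cur'' (var ''v'') (var ''fp'')) (Seq (for_loop ''w'' (var ''W1'') init_entry)
       (assign ''fp'' (NAdd (var ''fp'') (var ''W1''))))"
  have wr: "nat_writes init_entry = {tab 0, tab 1, tab 2}" "real_writes init_entry = {tab 0, tab 1, tab 2}"
    by (auto simp: init_entry_def Let_def)
  have nin: "a \<notin> {tab 0, tab 1, tab 2}" if "a = [] \<or> hd a \<noteq> CHR ''t''" for a
    using tab_neq[OF that] by auto
  {
    fix \<tau> assume "frame (for_loop ''v'' (var ''n'') ?body) \<sigma> \<tau>"
    then have "input \<tau>" by (rule input_frame[OF inp]) (simp_all add: wr)
    then show "nval (var ''n'') \<tau> = n" by (simp add: input_def)
  }
  fix k \<tau>
  assume k: "k < n" and inv: "tables \<tau> (\<lambda>v. {v}) (\<lambda>_. {}) {..<k} \<and> clean \<tau>"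
    and sm: "frame (for_loop ''v'' (var ''n'') ?body) \<sigma> \<tau>" and v: "fst \<tau> ''v'' 0 = k"
  have inp': "input \<tau>" by (rule input_frame[OF inp sm]) (simp_all add: wr)
  have W1': "fst \<tau> ''W1'' 0 = Suc W" using W1 by (simp add: frame_nat[OF sm] wr nin)
  define fp where "fp = fst \<tau> ''fp'' 0"
  define \<rho> where "\<rho> = (store ''cur'' k fp (fst \<tau>), snd \<tau>)"
  have inp\<rho>: "input \<rho>" using inp' by (simp add: \<rho>_def input_def store_apply)
  let ?I = "\<lambda>l \<rho>'. (\<forall>w<l. \<forall>s<3. holds \<rho>' (candidates {k} {} k s w) s (fp + w)) \<and>
    (\<forall>i<fp. same_entry \<tau> \<rho>' i) \<and> (\<forall>s<3. \<forall>i\<ge>fp + l. fst \<rho>' (tab s) i = 0)"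
  have "runs Z (for_loop ''w'' (var ''W1'') init_entry) \<rho> (?I (Suc W))"
  proof (rule runs_for_loop[where I = ?I and N = "Suc W"])
    show "?I 0 \<rho>" using inv by (simp add: \<rho>_def fp_def clean_def same_entry_refl)
  next
    fix l \<rho>' assume l: "l < Suc W" and I: "?I l \<rho>'" and w: "fst \<rho>' ''w'' 0 = l"
      and sm': "frame (for_loop ''w'' (var ''W1'') init_entry) \<rho> \<rho>'"
    have "input \<rho>'" by (rule input_frame[OF inp\<rho> sm']) (simp_all add: wr)
    moreover have "fst \<rho>' ''v'' 0 = k" "fst \<rho>' ''fp'' 0 = fp"
      by (simp_all add: frame_nat[OF sm'] wr nin) (simp_all add: \<rho>_def store_apply v fp_def)
    ultimately have "runs Z init_entry \<rho>' (\<lambda>\<sigma>'. (\<forall>s<3. \<forall>w. holds \<sigma>' (candidates {k} {} k s w) s (fp + l)) \<and>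
      (\<forall>i. i \<noteq> fp + l \<longrightarrow> same_entry \<rho>' \<sigma>' i))"
      using I w k by (intro runs_init_entry) auto
    then show "runs Z init_entry \<rho>' (?I (Suc l))"
    proof (rule runs_conseq)
      fix \<rho>'' assume r: "(\<forall>s<3. \<forall>w. holds \<rho>'' (candidates {k} {} k s w) s (fp + l)) \<and>
        (\<forall>i. i \<noteq> fp + l \<longrightarrow> same_entry \<rho>' \<rho>'' i)"
      show "?I (Suc l) \<rho>''"
      proof (intro conjI allI impI)
        fix w s :: nat assume "w < Suc l" "s < 3"
        then show "holds \<rho>'' (candidates {k} {} k s w) s (fp + w)"
          using r I by (cases "w = l") (auto simp: holds_same_entry[of \<rho>' \<rho>''])
      next
        fix i assume "i < fp"
        then have "same_entry \<tau> \<rho>' i" "same_entry \<rho>' \<rho>'' i" using r I by auto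
        then show "same_entry \<tau> \<rho>'' i" by (rule same_entry_trans)
      next
        fix s i :: nat assume "s < 3" "fp + Suc l \<le> i"
        then have "fst \<rho>' (tab s) i = 0" "same_entry \<rho>' \<rho>'' i" using I r by auto
        then show "fst \<rho>'' (tab s) i = 0" by (simp add: same_entry_def)
      qed
    qed
  next
    show "nval (var ''W1'') \<rho>' = Suc W" if "frame (for_loop ''w'' (var ''W1'') init_entry) \<rho> \<rho>'" for \<rho>'
      by (simp add: frame_nat[OF that] wr nin) (simp add: \<rho>_def store_apply W1')
  qed (simp_all add: Z_def wr nin)
  then have main: "runs Z (Seq (for_loop ''w'' (var ''W1'') init_entry)
      (assign ''fp'' (NAdd (var ''fp'') (var ''W1'')))) \<rho>
      (\<lambda>\<sigma>'. tables \<sigma>' (\<lambda>v. {v}) (\<lambda>_. {}) {..<Suc k} \<and> clean \<sigma>')"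
  proof (rule runs_seq_frame, intro runs_nstore)
    fix \<rho>' assume I: "?I (Suc W) \<rho>'" and sm': "frame (for_loop ''w'' (var ''W1'') init_entry) \<rho> \<rho>'"
    have eq: "fst \<rho>' ''fp'' 0 = fp" "fst \<rho>' ''W1'' 0 = Suc W" "fst \<rho>' ''cur'' v = (if v = k then fp else fst \<tau> ''cur'' v)" for v
      by (simp_all add: frame_nat[OF sm'] wr nin) (simp_all add: \<rho>_def store_apply v fp_def W1')
    let ?s = "(store ''fp'' (nval (NConst 0) \<rho>') (nval (NAdd (var ''fp'') (var ''W1'')) \<rho>') (fst \<rho>'), snd \<rho>')"
    have "clean ?s" using I by (simp add: clean_def store_apply eq)
    moreover have "tables ?s (\<lambda>v. {v}) (\<lambda>_. {}) {..<Suc k}"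
      unfolding tables_def
    proof (intro ballI)
      fix v assume v: "v \<in> {..<Suc k}"
      show "fst ?s ''cur'' v + W < fst ?s ''fp'' 0 \<and>
        (\<forall>s<3. \<forall>w\<le>W. holds ?s (candidates {v} {} v s w) s (fst ?s ''cur'' v + w))"
      proof (cases "v = k")
        case True
        then show ?thesis using I by (simp add: store_apply eq less_Suc_eq_le)
      next
        case False
        then have "v < k" using v by simp
        then have t: "fst \<tau> ''cur'' v + W < fp" "\<And>s w. s < 3 \<Longrightarrow> w \<le> W \<Longrightarrow>
            holds \<tau> (candidates {v} {} v s w) s (fst \<tau> ''cur'' v + w)"
          using inv by (auto simp: tables_def fp_def)
        then have "same_entry \<tau> \<rho>' (fst \<tau> ''cur'' v + w)" if "w \<le> W" for w using I that by simp
        then have "holds \<rho>' X s (fst \<tau> ''cur'' v + w) = holds \<tau> X s (fst \<tau> ''cur'' v + w)"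
          if "w \<le> W" for X s w using that by (simp add: holds_same_entry)
        then show ?thesis using t False by (simp add: store_apply eq)
      qed
    qed
    ultimately show "tables ?s (\<lambda>v. {v}) (\<lambda>_. {}) {..<Suc k} \<and> clean ?s" by simp
  qed
  show "runs Z ?body \<tau> (\<lambda>\<sigma>'. tables \<sigma>' (\<lambda>v. {v}) (\<lambda>_. {}) {..<Suc k} \<and> clean \<sigma>')"
    by (rule runs_seq, rule runs_nstore) (use main in \<open>simp add: \<rho>_def v fp_def\<close>)
qed (use cl in \<open>simp_all add: Z_def tables_def clean_def store_apply init_entry_def Let_def\<close>)

section \<open>Growing the visited set\<close>

definition reach :: "(nat \<Rightarrow> nat) \<Rightarrow> nat \<Rightarrow> nat set" where
  "reach chi k = insert 0 (chi ` {..<k})"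

text \<open>The visited set is a function of \<open>chi\<close> and the round alone, so extending
  the arrays at index \<open>k\<close> leaves the conditions of earlier rounds intact.\<close>

definition growing :: "(nat \<Rightarrow> nat) \<Rightarrow> (nat \<Rightarrow> nat) \<Rightarrow> (nat \<Rightarrow> nat) \<Rightarrow> nat \<Rightarrow> bool" where
  "growing par chi eid k \<longleftrightarrow> (\<forall>j<k. eid j < m \<and> ed (eid j) = {par j, chi j} \<and>
     par j \<in> reach chi j \<and> chi j \<notin> reach chi j \<and> chi j < n)"

lemma reach_Suc: "reach chi (Suc k) = insert (chi k) (reach chi k)"
  by (auto simp: reach_def lessThan_Suc)

lemma growing_Suc: "growing par chi eid (Suc k) \<longleftrightarrow> growing par chi eid k \<and> eid k < m \<and>
  ed (eid k) = {par k, chi k} \<and> par k \<in> reach chi k \<and> chi k \<notin> reach chi k \<and> chi k < n"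
  by (auto simp: growing_def less_Suc_eq)

lemma growing_reach:
  assumes "growing par chi eid k"
  shows "reach chi k \<subseteq> V" "card (reach chi k) = Suc k"
  using assms
proof (induction k)
  case 0
  { case 1 then show ?case using n_pos by (simp add: reach_def) }
  { case 2 then show ?case by (simp add: reach_def) }
next
  case (Suc k)
  { case 1 then show ?case using Suc by (simp add: growing_Suc reach_Suc) }
  { case 2 then show ?case using Suc by (simp add: growing_Suc reach_Suc) (simp add: reach_def) }
qed

text \<open>Vertex 0 and \<open>n - 1\<close> distinct children exhaust the \<open>n\<close>
  vertices. The chosen edges connect all of them to 0, and in a tree a connecting set of edges is
  complete.\<close>

lemma growing_all:
  assumes g: "growing par chi eid (n - 1)"
  shows "reach chi (n - 1) = V" "(\<lambda>j. ed (eid j)) ` {..<n - 1} = E"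
proof -
  show V: "reach chi (n - 1) = V"
    using growing_reach[OF g] n_pos by (intro card_subset_eq) auto
  let ?D = "(\<lambda>j. ed (eid j)) ` {..<n - 1}"
  have "\<forall>x\<in>reach chi k. (0, x) \<in> (adj ?D)\<^sup>*" if "k \<le> n - 1" for k
    using that
  proof (induction k)
    case 0
    then show ?case by (simp add: reach_def)
  next
    case (Suc k)
    then have "par k \<in> reach chi k" "ed (eid k) = {par k, chi k}" using g by (auto simp: growing_def)
    moreover have "ed (eid k) \<in> ?D" using Suc.prems by auto
    ultimately have "(0, par k) \<in> (adj ?D)\<^sup>*" "(par k, chi k) \<in> adj ?D"
      using Suc by (auto simp: adj_def)
    then show ?case using Suc by (auto simp: reach_Suc)
  qed
  then have "\<And>x. x \<in> V \<Longrightarrow> (0, x) \<in> (adj ?D)\<^sup>*" using V by blast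
  moreover have "?D \<subseteq> E"
  proof (rule image_subsetI)
    fix j assume "j \<in> {..<n - 1}"
    then have "eid j < m" using g by (simp add: growing_def)
    then show "ed (eid j) \<in> E" by (rule ed_mem)
  qed
  ultimately show "?D = E" using tree_graph_spanning_subset[OF tree_facts(1)] by blast
qed

text \<open>Without such an edge \<open>S\<close> would be closed under adjacency and contain the
  component of 0, which is all of \<open>V\<close>.\<close>

lemma crossing_edge:
  assumes "S \<subseteq> V" "S \<noteq> V" "0 \<in> S"
  shows "\<exists>i<m. (fst (es ! i) \<in> S) \<noteq> (snd (es ! i) \<in> S)"
proof (rule ccontr)
  assume h: "\<not> ?thesis"
  have "v \<in> S" if u: "u \<in> S" and e: "{u, v} \<in> E" for u v
  proof -
    obtain i where i: "i < m" "{u, v} = {fst (es ! i), snd (es ! i)}"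
      using ed_surj[OF e] by (auto simp: ed_def)
    have "(fst (es ! i) \<in> S) = (snd (es ! i) \<in> S)" using h i(1) by blast
    then show ?thesis using i(2) u by (auto simp: doubleton_eq_iff)
  qed
  then have "component V E 0 \<subseteq> S"
    using assms(3) adj_rtrancl_closed[of 0 _ E S] by (auto simp: component_def)
  moreover have "component V E 0 = V"
    using tree_facts(1) n_pos by (auto simp: tree_graph_def connected_graph_def)
  ultimately show False using assms by blast
qed

lemma runs_search:
  assumes inp: "input \<sigma>" and vis: "\<And>v. fst \<sigma> ''vis'' v = of_bool (v \<in> S)"
    and S: "S \<subseteq> V" "S \<noteq> V" "0 \<in> S"
  shows "runs Z search \<sigma> (\<lambda>\<sigma>'. \<exists>i<m. fst \<sigma>' ''sel'' 0 = i \<and> (fst (es ! i) \<in> S) \<noteq> (snd (es ! i) \<in> S))"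
proof -
  define cross where "cross i \<longleftrightarrow> (fst (es ! i) \<in> S) \<noteq> (snd (es ! i) \<in> S)" for i
  \<comment> \<open>An implication, since the edges scanned so far need not contain a crossing one;
    \<open>crossing_edge\<close> supplies the premise at the end.\<close>
  let ?I = "\<lambda>k (\<tau> :: state). (\<exists>i<k. cross i) \<longrightarrow> (\<exists>i<m. fst \<tau> ''sel'' 0 = i \<and> cross i)"
  have "runs Z search \<sigma> (?I m)"
    unfolding search_def Let_def
  proof (rule runs_for_loop[where I = ?I and N = m])
    let ?a = "NLoad ''vis'' (NLoad ''src'' (var ''i''))" and ?b = "NLoad ''vis'' (NLoad ''dst'' (var ''i''))"
    let ?c = "Cond (BAnd (NLe ?a ?b) (NLe ?b ?a)) Skip (assign ''sel'' (var ''i''))"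
    fix k \<tau> assume k: "k < m" and I: "?I k \<tau>" and sm: "frame (for_loop ''i'' (var ''m'') ?c) \<sigma> \<tau>"
      and i: "fst \<tau> ''i'' 0 = k"
    have "input \<tau>" by (rule input_frame[OF inp sm]) simp_all
    then have "bval (BAnd (NLe ?a ?b) (NLe ?b ?a)) \<tau> \<longleftrightarrow> \<not> cross k"
      using k by (auto simp: input_def i frame_nat[OF sm] vis cross_def of_bool_def)
    then show "runs Z ?c \<tau> (?I (Suc k))"
      using I k by (intro runs_cond runs_skip runs_nstore) (auto simp: less_Suc_eq store_apply i)
  qed (use inp in \<open>simp_all add: Z_def input_def store_apply frame_nat\<close>)
  then show ?thesis
    by (rule runs_conseq) (use crossing_edge[OF S] in \<open>auto simp: cross_def\<close>)
qed

lemma runs_order_phase: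
  assumes inp: "input \<sigma>" and vis: "fst \<sigma> ''vis'' = (\<lambda>_. 0)"
  shows "runs Z order_phase \<sigma> (\<lambda>\<sigma>'. fst \<sigma>' ''N'' 0 = n - 1 \<and>
    growing (fst \<sigma>' ''par'') (fst \<sigma>' ''chi'') (fst \<sigma>' ''eid'') (n - 1))"
proof -
  define J where "J k (\<tau> :: state) \<longleftrightarrow> growing (fst \<tau> ''par'') (fst \<tau> ''chi'') (fst \<tau> ''eid'') k \<and>
    (\<forall>v. fst \<tau> ''vis'' v = of_bool (v \<in> reach (fst \<tau> ''chi'') k))" for k \<tau>
  define select where "select = Cond (NLe one (NLoad ''vis'' (var ''a'')))
             (Seq (NStore ''par'' (var ''k'') (var ''a'')) (NStore ''chi'' (var ''k'') (var ''b'')))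
             (Seq (NStore ''par'' (var ''k'') (var ''b'')) (NStore ''chi'' (var ''k'') (var ''a'')))"
  define body where "body = Seq search
      (Seq (assign ''a'' (NLoad ''src'' (var ''sel'')))
      (Seq (assign ''b'' (NLoad ''dst'' (var ''sel'')))
      (Seq select
      (Seq (NStore ''eid'' (var ''k'') (var ''sel''))
        (NStore ''vis'' (NLoad ''chi'' (var ''k'')) one)))))"
  have wr: "nat_writes body = {''i'', ''sel'', ''a'', ''b'', ''par'', ''chi'', ''eid'', ''vis''}" "real_writes body = {}"
    by (auto simp: body_def select_def search_def Let_def)
  have wr_search: "nat_writes search = {''i'', ''sel''}" "real_writes search = {}"
    by (auto simp: search_def Let_def)
  define \<tau> where "\<tau> = (store ''N'' 0 (n - 1) (store ''vis'' 0 1 (fst \<sigma>)), snd \<sigma>)"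
  have inp\<tau>: "input \<tau>" using inp by (simp add: \<tau>_def input_def store_apply)
  have "runs Z (for_loop ''k'' (var ''N'') body) \<tau> (\<lambda>\<sigma>'. fst \<sigma>' ''N'' 0 = n - 1 \<and>
    growing (fst \<sigma>' ''par'') (fst \<sigma>' ''chi'') (fst \<sigma>' ''eid'') (n - 1))"
  proof (rule runs_for_loop[where I = J and N = "n - 1"])
    show "J 0 \<tau>" by (simp add: J_def growing_def reach_def \<tau>_def store_apply vis)
    show "J k (store ''k'' 0 v (fst s), snd s)" if "J k s" for k s v
      using that by (simp add: J_def store_def)
  next
    fix k \<rho> assume k: "k < n - 1" and J: "J k \<rho>" and sm: "frame (for_loop ''k'' (var ''N'') body) \<tau> \<rho>"
      and kk: "fst \<rho> ''k'' 0 = k"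
    let ?par = "fst \<rho> ''par''" and ?chi = "fst \<rho> ''chi''" and ?eid = "fst \<rho> ''eid''"
    define S where "S = reach ?chi k"
    have g: "growing ?par ?chi ?eid k" and vis: "\<And>v. fst \<rho> ''vis'' v = of_bool (v \<in> S)"
      using J by (auto simp: J_def S_def)
    \<comment> \<open>After \<open>k < n - 1\<close> rounds only \<open>k + 1\<close> vertices are
      visited, so a crossing edge still exists.\<close>
    have S: "S \<subseteq> V" "S \<noteq> V" "0 \<in> S"
      using growing_reach[OF g] k by (auto simp: S_def reach_def)
    have inp\<rho>: "input \<rho>" by (rule input_frame[OF inp\<tau> sm]) (simp_all add: wr)
    show "runs Z body \<rho> (J (Suc k))"
      unfolding body_def
    proof (rule runs_seq_frame[OF runs_search[OF inp\<rho> vis S]])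
      fix \<rho>' assume "\<exists>i<m. fst \<rho>' ''sel'' 0 = i \<and> (fst (es ! i) \<in> S) \<noteq> (snd (es ! i) \<in> S)"
        and sm': "frame search \<rho> \<rho>'"
      then obtain i where i: "i < m" "fst \<rho>' ''sel'' 0 = i" "(fst (es ! i) \<in> S) \<noteq> (snd (es ! i) \<in> S)"
        by blast
      have "input \<rho>'" by (rule input_frame[OF inp\<rho> sm']) (simp_all add: wr_search)
      then have ends: "fst \<rho>' ''src'' i = fst (es ! i)" "fst \<rho>' ''dst'' i = snd (es ! i)"
        using i by (auto simp: input_def)
      have eqs: "fst \<rho>' ''par'' = ?par" "fst \<rho>' ''chi'' = ?chi" "fst \<rho>' ''eid'' = ?eid"
        "fst \<rho>' ''vis'' = fst \<rho> ''vis''" "fst \<rho>' ''k'' 0 = k"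
        by (simp_all add: frame_nat[OF sm'] wr_search kk)
      \<comment> \<open>Both orientations of the selected edge are treated at once, with
        \<open>p\<close> the visited end and \<open>c\<close> the new one.\<close>
      have step: "J (Suc k) \<sigma>'"
        if "{p, c} = ed i" "p \<in> S" "c \<notin> S" "fst \<sigma>' ''par'' = ?par(k := p)"
          "fst \<sigma>' ''chi'' = ?chi(k := c)" "fst \<sigma>' ''eid'' = ?eid(k := i)"
          "fst \<sigma>' ''vis'' = (fst \<rho> ''vis'')(c := 1)" for p c \<sigma>'
      proof -
        have r: "reach (?chi(k := c)) j = reach ?chi j" if "j \<le> k" for j
          using that by (auto simp: reach_def)
        have "growing (?par(k := p)) (?chi(k := c)) (?eid(k := i)) k"
          using g by (auto simp: growing_def r)
        moreover have "c < n" using that(1) edgeD(1)[OF ed_mem[OF i(1)]] by auto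
        ultimately have "growing (?par(k := p)) (?chi(k := c)) (?eid(k := i)) (Suc k)"
          using that i by (simp add: growing_Suc r S_def)
        moreover have "reach (?chi(k := c)) (Suc k) = insert c S" by (simp add: reach_Suc r S_def)
        ultimately show ?thesis using that vis by (auto simp: J_def)
      qed
      show "runs Z (Seq (assign ''a'' (NLoad ''src'' (var ''sel'')))
        (Seq (assign ''b'' (NLoad ''dst'' (var ''sel'')))
        (Seq select
        (Seq (NStore ''eid'' (var ''k'') (var ''sel''))
          (NStore ''vis'' (NLoad ''chi'' (var ''k'')) one))))) \<rho>' (J (Suc k))"
      proof (rule runs_seq, rule runs_nstore, rule runs_seq, rule runs_nstore)
        define \<chi> where "\<chi> = (store ''b'' 0 (snd (es ! i)) (store ''a'' 0 (fst (es ! i)) (fst \<rho>')), snd \<rho>')"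
        have "runs Z (Seq select (Seq (NStore ''eid'' (var ''k'') (var ''sel''))
          (NStore ''vis'' (NLoad ''chi'' (var ''k'')) one))) \<chi> (J (Suc k))"
          unfolding select_def
        proof (rule runs_seq, rule runs_cond, goal_cases)
          case 1
          then have "fst (es ! i) \<in> S" by (cases "fst (es ! i) \<in> S") (simp_all add: \<chi>_def store_apply eqs vis)
          then show ?case using i
            by (intro runs_seq runs_nstore, intro step[of "fst (es ! i)" "snd (es ! i)"])
              (simp_all add: \<chi>_def store_apply eqs ed_def, simp_all add: store_def eqs)
        next
          case 2
          then have "fst (es ! i) \<notin> S" by (cases "fst (es ! i) \<in> S") (simp_all add: \<chi>_def store_apply eqs vis)
          then show ?case using i
            by (intro runs_seq runs_nstore, intro step[of "snd (es ! i)" "fst (es ! i)"])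
              (simp_all add: \<chi>_def store_apply eqs ed_def insert_commute, simp_all add: store_def eqs)
        qed
        moreover have "\<chi> = (store ''b'' 0 (fst \<rho>' ''dst'' (fst \<rho>' ''sel'' 0))
            (store ''a'' 0 (fst \<rho>' ''src'' (fst \<rho>' ''sel'' 0)) (fst \<rho>')), snd \<rho>')"
          by (simp add: \<chi>_def i(2) ends)
        ultimately show "runs Z (Seq select (Seq (NStore ''eid'' (var ''k'') (var ''sel''))
          (NStore ''vis'' (NLoad ''chi'' (var ''k'')) one)))
          (store ''b'' (nval (NConst 0) (store ''a'' (nval (NConst 0) \<rho>') (nval (NLoad ''src'' (var ''sel'')) \<rho>') (fst \<rho>'), snd \<rho>'))
            (nval (NLoad ''dst'' (var ''sel'')) (store ''a'' (nval (NConst 0) \<rho>') (nval (NLoad ''src'' (var ''sel'')) \<rho>') (fst \<rho>'), snd \<rho>'))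
            (fst (store ''a'' (nval (NConst 0) \<rho>') (nval (NLoad ''src'' (var ''sel'')) \<rho>') (fst \<rho>'), snd \<rho>')),
           snd (store ''a'' (nval (NConst 0) \<rho>') (nval (NLoad ''src'' (var ''sel'')) \<rho>') (fst \<rho>'), snd \<rho>')) (J (Suc k))"
          by (simp add: store_apply)
      qed
    qed
  next
    show "nval (var ''N'') \<rho> = n - 1" if "frame (for_loop ''k'' (var ''N'') body) \<tau> \<rho>" for \<rho>
      by (simp add: frame_nat[OF that] wr) (simp add: \<tau>_def store_apply)
    show "fst \<rho> ''N'' 0 = n - 1 \<and> growing (fst \<rho> ''par'') (fst \<rho> ''chi'') (fst \<rho> ''eid'') (n - 1)"
      if "J (n - 1) \<rho>" "frame (for_loop ''k'' (var ''N'') body) \<tau> \<rho>" for \<rho>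
      using that(1) by (simp add: frame_nat[OF that(2)] wr J_def) (simp add: \<tau>_def store_apply)
  qed (simp_all add: Z_def wr)
  then show ?thesis
    unfolding order_phase_def select_def[symmetric] body_def[symmetric]
    using inp by (intro runs_seq runs_nstore) (simp add: \<tau>_def store_apply input_def)
qed

section \<open>Backward merging of the partial subtrees\<close>

definition forest :: "(nat \<Rightarrow> nat set) \<Rightarrow> (nat \<Rightarrow> nat set set) \<Rightarrow> nat set \<Rightarrow> nat set set \<Rightarrow> bool" where
  "forest K D A F \<longleftrightarrow> (\<forall>v\<in>A. v \<in> K v \<and> K v \<subseteq> V \<and> (\<forall>e\<in>D v. e \<subseteq> K v \<and> e \<noteq> {})) \<and>
     (\<forall>u\<in>A. \<forall>v\<in>A. u \<noteq> v \<longrightarrow> K u \<inter> K v = {}) \<and> (\<Union>v\<in>A. K v) = V \<and> (\<Union>v\<in>A. D v) = F"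

lemma forest_merge:
  assumes f: "forest K D (insert c A) F" and p: "p \<in> A" and c: "c \<notin> A"
  shows "forest (K(p := K p \<union> K c)) (D(p := insert {p, c} (D p \<union> D c))) A (insert {p, c} F)"
  unfolding forest_def
proof (intro conjI)
  have cp: "c \<in> K c" "p \<in> K p" using f p by (auto simp: forest_def)
  show "\<forall>v\<in>A. v \<in> (K(p := K p \<union> K c)) v \<and> (K(p := K p \<union> K c)) v \<subseteq> V \<and>
      (\<forall>e\<in>(D(p := insert {p, c} (D p \<union> D c))) v. e \<subseteq> (K(p := K p \<union> K c)) v \<and> e \<noteq> {})"
  proof
    fix v assume v: "v \<in> A"
    have all: "\<forall>v\<in>insert c A. v \<in> K v \<and> K v \<subseteq> V \<and> (\<forall>e\<in>D v. e \<subseteq> K v \<and> e \<noteq> {})"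
      using f unfolding forest_def by (rule conjunct1)
    have K: "u \<in> K u" "K u \<subseteq> V" "\<And>e. e \<in> D u \<Longrightarrow> e \<subseteq> K u \<and> e \<noteq> {}" if "u \<in> insert c A" for u
      using bspec[OF all that] by simp_all
    show "v \<in> (K(p := K p \<union> K c)) v \<and> (K(p := K p \<union> K c)) v \<subseteq> V \<and>
      (\<forall>e\<in>(D(p := insert {p, c} (D p \<union> D c))) v. e \<subseteq> (K(p := K p \<union> K c)) v \<and> e \<noteq> {})"
    proof (cases "v = p")
      case True
      then show ?thesis using K[of p] K[of c] p cp by simp blast
    next
      case False
      then show ?thesis using K[of v] v by simp
    qed
  qed
  have d: "K u \<inter> K v = {}" if "u \<in> insert c A" "v \<in> insert c A" "u \<noteq> v" for u v
    using f that unfolding forest_def by blast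
  show "\<forall>u\<in>A. \<forall>v\<in>A. u \<noteq> v \<longrightarrow> (K(p := K p \<union> K c)) u \<inter> (K(p := K p \<union> K c)) v = {}"
  proof (intro ballI impI)
    fix u v assume "u \<in> A" "v \<in> A" "u \<noteq> v"
    then show "(K(p := K p \<union> K c)) u \<inter> (K(p := K p \<union> K c)) v = {}"
      using d[of u v] d[of u c] d[of c v] c by (auto simp: Int_Un_distrib Int_Un_distrib2)
  qed
  show "(\<Union>v\<in>A. (K(p := K p \<union> K c)) v) = V"
    using f p unfolding forest_def by (auto split: if_splits)
  show "(\<Union>v\<in>A. (D(p := insert {p, c} (D p \<union> D c))) v) = insert {p, c} F"
    using f p unfolding forest_def by (auto split: if_splits)
qed

text \<open>After \<open>k\<close> rounds the roots are vertex 0 and the children found in the first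
  \<open>n - 1 - k\<close> search rounds, and the edges of index \<open>n - 1 - k\<close> or higher
  lie inside the subtrees. The child found last is the next root to disappear, which is why removing
  it just steps back in \<open>reach\<close>.\<close>

lemma runs_merge_phase:
  assumes inp: "input \<sigma>" and N: "fst \<sigma> ''N'' 0 = n - 1" and W1: "fst \<sigma> ''W1'' 0 = Suc W"
    and pw: "\<And>i. i \<le> m \<Longrightarrow> fst \<sigma> ''pw'' i = 2 ^ i"
    and g: "growing (fst \<sigma> ''par'') (fst \<sigma> ''chi'') (fst \<sigma> ''eid'') (n - 1)"
    and tab: "tables \<sigma> (\<lambda>v. {v}) (\<lambda>_. {}) {..<n}" and cl: "clean \<sigma>"
  shows "runs Z merge_phase \<sigma> (\<lambda>\<sigma>'. tables \<sigma>' (\<lambda>_. V) (\<lambda>_. E) {0})"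
proof -
  define par where "par = fst \<sigma> ''par''"
  define chi where "chi = fst \<sigma> ''chi''"
  define eid where "eid = fst \<sigma> ''eid''"
  define R where "R r = reach chi r" for r
  define F where "F r = (\<lambda>j. ed (eid j)) ` {r..<n - 1}" for r
  define J where "J k \<tau> \<longleftrightarrow> (\<exists>K D. forest K D (R (n - 1 - k)) (F (n - 1 - k)) \<and>
    tables \<tau> K D (R (n - 1 - k)) \<and> clean \<tau>)" for k \<tau>
  define tail where "tail = Seq merge_table
     (Seq (NStore ''cur'' (var ''p'') (var ''fp''))
       (assign ''fp'' (NAdd (var ''fp'') (var ''W1''))))"
  define body where "body = Seq (assign ''j'' (NSub (NSub (var ''N'') one) (var ''k'')))
     (Seq (assign ''p'' (NLoad ''par'' (var ''j'')))
     (Seq (assign ''bp'' (NLoad ''cur'' (var ''p'')))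
     (Seq (assign ''bc'' (NLoad ''cur'' (NLoad ''chi'' (var ''j''))))
     (Seq (assign ''ce'' (NLoad ''cost'' (NLoad ''eid'' (var ''j''))))
     (Seq (assign ''pe'' (NLoad ''pw'' (NLoad ''eid'' (var ''j''))))
     tail)))))"
  have gN: "growing par chi eid (n - 1)" using g by (simp add: par_def chi_def eid_def)
  have "runs Z (for_loop ''k'' (var ''N'') body) \<sigma> (\<lambda>\<sigma>'. tables \<sigma>' (\<lambda>_. V) (\<lambda>_. E) {0})"
  proof (rule runs_for_loop[where I = J and N = "n - 1"])
    have "forest (\<lambda>v. {v}) (\<lambda>_. {}) V {}" by (auto simp: forest_def)
    then show "J 0 \<sigma>"
      using tab cl growing_all(1)[OF gN] by (auto simp: J_def R_def F_def)
  next
    fix k \<tau> v assume "J k \<tau>"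
    then show "J k (store ''k'' 0 v (fst \<tau>), snd \<tau>)"
      by (simp add: J_def tables_def clean_def store_apply)
  next
    fix \<tau> assume "J (n - 1) \<tau>"
    then obtain K D where f: "forest K D {0} (F 0)" and t: "tables \<tau> K D {0}"
      by (auto simp: J_def R_def reach_def)
    have "F 0 = E" using growing_all(2)[OF gN] by (simp add: F_def atLeast0LessThan)
    then have "K 0 = V" "D 0 = E" using f by (auto simp: forest_def)
    then show "tables \<tau> (\<lambda>_. V) (\<lambda>_. E) {0}" using t by (simp add: tables_def)
  next
    fix k \<tau> assume k: "k < n - 1" and J: "J k \<tau>" and sm: "frame (for_loop ''k'' (var ''N'') body) \<sigma> \<tau>"
      and kk: "fst \<tau> ''k'' 0 = k"
    \<comment> \<open>The highest index not yet merged, which the program computes as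
      \<open>N - 1 - k\<close>.\<close>
    define j where "j = n - 2 - k"
    have j: "n - 1 - k = Suc j" "n - 1 - Suc k = j" "n - 1 - 1 - k = j" "j < n - 1" using k by (auto simp: j_def)
    define p where "p = par j"
    define c where "c = chi j"
    define e where "e = eid j"
    have grow: "e < m" "ed e = {p, c}" "p \<in> R j" "c \<notin> R j"
      using gN j(4) by (auto simp: growing_def p_def c_def e_def R_def)
    have RS: "R (Suc j) = insert c (R j)" by (simp add: R_def reach_Suc c_def)
    obtain K D where f: "forest K D (insert c (R j)) (F (Suc j))" and t: "tables \<tau> K D (insert c (R j))"
      and cl': "clean \<tau>" using J unfolding J_def j RS by blast
    have Fj: "F j = insert {p, c} (F (Suc j))"
    proof -
      have "{j..<n - 1} = insert j {Suc j..<n - 1}" using j(4) by auto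
      then show ?thesis using grow(2) by (simp add: F_def e_def)
    qed
    have inp': "input \<tau>"
      by (rule input_frame[OF inp sm]) (simp_all add: body_def tail_def merge_table_def)
    have eqs: "fst \<tau> ''N'' 0 = n - 1" "fst \<tau> ''W1'' 0 = Suc W" "fst \<tau> ''par'' = par" "fst \<tau> ''chi'' = chi"
      "fst \<tau> ''eid'' = eid" "fst \<tau> ''pw'' e = 2 ^ e"
      using N W1 pw grow(1)
      by (simp_all add: frame_nat[OF sm] body_def tail_def merge_table_def par_def chi_def eid_def)
    have cost: "fst \<tau> ''cost'' e = cost I {p, c}" using inp' grow by (simp add: input_def)
    have code: "2 ^ e = code {p, c}" using code_ed[OF grow(1)] grow(2) by simp
    define fp where "fp = fst \<tau> ''fp'' 0"
    define bp where "bp = fst \<tau> ''cur'' p"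
    define bc where "bc = fst \<tau> ''cur'' c"
    define \<rho> where "\<rho> = (store ''pe'' 0 (code {p, c}) (store ''ce'' 0 (cost I {p, c}) (store ''bc'' 0 bc
      (store ''bp'' 0 bp (store ''p'' 0 p (store ''j'' 0 j (fst \<tau>)))))), snd \<tau>)"
    have \<rho>: "holds \<rho> X s i = holds \<tau> X s i" "same_entry \<rho> x i = same_entry \<tau> x i" "fst \<rho> (tab s) = fst \<tau> (tab s)"
      "fst \<rho> ''cur'' = fst \<tau> ''cur''" "fst \<rho> ''fp'' 0 = fp" "fst \<rho> ''W1'' 0 = Suc W" "fst \<rho> ''p'' 0 = p" for X s i x
      by (simp_all add: \<rho>_def holds_def same_entry_def fp_def eqs) (simp_all add: store_def eqs fp_def)
    let ?A = "\<lambda>w s. candidates (K p) (D p) p s w" and ?B = "\<lambda>w s. candidates (K c) (D c) c s w"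
    let ?K = "K(p := K p \<union> K c)" and ?D = "D(p := insert {p, c} (D p \<union> D c))"
    have pc: "p \<noteq> c" using grow by auto
    \<comment> \<open>Here the recursion enters: the abstract unions computed by
      \<open>merge_table\<close> become the candidates of the joined subtree.\<close>
    have whole: "(\<Union>u<Suc w. split_set (cost I {p, c}) (code {p, c}) ?A ?B w u s) =
        candidates (?K p) (?D p) p s w" if "s < 3" for s w
    proof -
      have fin: "finite (K p)" "finite (K c)" and mem: "p \<in> K p" "c \<in> K c"
        and dis: "K p \<inter> K c = {}" and ed: "\<And>e. e \<in> D p \<Longrightarrow> e \<subseteq> K p \<and> e \<noteq> {}"
          "\<And>e. e \<in> D c \<Longrightarrow> e \<subseteq> K c \<and> e \<noteq> {}"
        using f grow(3) pc by (auto simp: forest_def intro: finite_subset[of _ V])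
      show ?thesis
        unfolding split_set_def fun_upd_same
        by (rule candidates_merge[OF fin dis mem, symmetric]) (use ed that in blast)+
    qed
    have fp: "fst \<tau> ''cur'' v + W < fp" if "v \<in> insert c (R j)" for v
      using t that by (auto simp: tables_def fp_def)
    have old: "holds \<tau> (candidates (K v) (D v) v s w) s (fst \<tau> ''cur'' v + w)"
      if "v \<in> insert c (R j)" "s < 3" "w \<le> W" for v s w
      using t that by (auto simp: tables_def)
    have "runs Z merge_table \<rho> (\<lambda>\<sigma>'.
      (\<forall>w<Suc W. \<forall>s<3. holds \<sigma>' (\<Union>u<Suc w. split_set (cost I {p, c}) (code {p, c}) ?A ?B w u s) s (fp + w)) \<and>
      (\<forall>i<fp. same_entry \<rho> \<sigma>' i) \<and> (\<forall>s<3. \<forall>i\<ge>fp + Suc W. fst \<sigma>' (tab s) i = 0))"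
    proof (rule runs_merge_table)
      show "holds \<rho> (?A w s) s (bp + w)" if "s < 3" "w \<le> W" for s w
        using old[of p s w] that grow(3) by (simp add: \<rho> bp_def)
      show "holds \<rho> (?B w s) s (bc + w)" if "s < 3" "w \<le> W" for s w
        using old[of c s w] that by (simp add: \<rho> bc_def)
      show "fst \<rho> (tab s) i = 0" if "s < 3" "fp \<le> i" for s i
        using that cl' by (simp add: \<rho> clean_def fp_def)
      show "bp + W < fp" "bc + W < fp" using fp[of p] fp[of c] grow(3) by (auto simp: bp_def bc_def)
    qed (simp_all add: \<rho>, simp_all add: \<rho>_def store_apply Z_def)
    then have tail: "runs Z tail \<rho> (J (Suc k))"
      unfolding tail_def
    proof (rule runs_seq_frame, goal_cases)
      case (1 \<rho>')
      note sm' = 1(2)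
      have eq: "fst \<rho>' ''p'' 0 = p" "fst \<rho>' ''fp'' 0 = fp" "fst \<rho>' ''W1'' 0 = Suc W"
        "fst \<rho>' ''cur'' = fst \<tau> ''cur''"
        by (simp_all add: frame_nat[OF sm'] merge_table_def \<rho>)
      define \<sigma>' where "\<sigma>' = (store ''fp'' 0 (fp + Suc W) (store ''cur'' p fp (fst \<rho>')), snd \<rho>')"
      have \<sigma>': "holds \<sigma>' X s i = holds \<rho>' X s i" "fst \<sigma>' (tab s) = fst \<rho>' (tab s)"
        "fst \<sigma>' ''fp'' 0 = fp + Suc W" "fst \<sigma>' ''cur'' v = (if v = p then fp else fst \<tau> ''cur'' v)" for X s i v
        by (simp_all add: \<sigma>'_def holds_def) (simp_all add: store_apply eq)
      have "clean \<sigma>'" using 1(1) by (simp add: clean_def \<sigma>')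
      moreover have "tables \<sigma>' ?K ?D (R j)"
        unfolding tables_def
      proof (intro ballI conjI allI impI)
        fix v assume "v \<in> R j"
        then show "fst \<sigma>' ''cur'' v + W < fst \<sigma>' ''fp'' 0"
          using fp[of v] by (simp add: \<sigma>')
      next
        fix v s w assume v: "v \<in> R j" and s: "s < (3::nat)" and w: "w \<le> W"
        show "holds \<sigma>' (candidates (?K v) (?D v) v s w) s (fst \<sigma>' ''cur'' v + w)"
        proof (cases "v = p")
          case True
          have "holds \<rho>' (candidates (?K p) (?D p) p s w) s (fp + w)"
            using 1(1) s w unfolding whole[OF s, symmetric] by simp
          then show ?thesis using True by (simp add: \<sigma>')
        next
          case False
          have "fst \<tau> ''cur'' v + w < fp" using fp[of v] v w by simp
          then have "same_entry \<tau> \<rho>' (fst \<tau> ''cur'' v + w)" using 1(1) by (simp add: \<rho>)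
          then show ?thesis using old[of v s w] v s w False by (simp add: \<sigma>' holds_same_entry)
        qed
      qed
      ultimately have "J (Suc k) \<sigma>'"
        using forest_merge[OF f grow(3,4)] unfolding J_def j Fj by blast
      then show ?case
        by (intro runs_seq runs_nstore) (simp add: \<sigma>'_def eq store_apply)
    qed
    show "runs Z body \<tau> (J (Suc k))"
      unfolding body_def
      by (rule runs_seq, rule runs_nstore, rule runs_seq, rule runs_nstore, rule runs_seq, rule runs_nstore,
          rule runs_seq, rule runs_nstore, rule runs_seq, rule runs_nstore, rule runs_seq, rule runs_nstore)
        (use tail in \<open>simp add: store_apply eqs kk j(3)[simplified] cost code \<rho>_def bp_def bc_def
           flip: p_def c_def e_def\<close>)
  next
    show "nval (var ''N'') \<tau> = n - 1" if "frame (for_loop ''k'' (var ''N'') body) \<sigma> \<tau>" for \<tau>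
      by (simp add: frame_nat[OF that] body_def tail_def merge_table_def N)
  qed (simp_all add: Z_def body_def tail_def merge_table_def)
  then show ?thesis
    unfolding merge_phase_def tail_def body_def .
qed

section \<open>Reading off an optimal cut system\<close>

lemma final_candidates:
  assumes H: "H \<subseteq> E" "sum (cost I) H \<le> W"
  shows "\<exists>s<2. (wfl_risk I H, sum code H) \<in> candidates V E 0 s W"
proof -
  define s :: nat where "s = of_bool (burns V (E - H) 0)"
  have "promise s = of_bool (burns V (E - H) 0)" "burns V (E - H) 0 = ignited s"
    by (auto simp: s_def promise_def ignited_def)
  then have "(promised_risk V (E - H) 0 (of_bool (burns V (E - H) 0)), sum code H) \<in> candidates V E 0 s W"
    using H unfolding candidates_def by fastforce
  then show ?thesis unfolding promised_risk_burns wfl_risk_eq by (intro exI[of _ s]) (simp add: s_def)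
qed

text \<open>In states 0 and 1 the promise at the root equals the truth, so the promised risk is the
  risk itself.\<close>

lemma final_candidatesD:
  assumes "(r, c) \<in> candidates V E 0 s W" "s < 2"
  shows "\<exists>H. H \<subseteq> E \<and> sum (cost I) H \<le> W \<and> r = wfl_risk I H \<and> c = sum code H"
proof -
  obtain H where H: "H \<subseteq> E" "sum (cost I) H \<le> W" "burns V (E - H) 0 = ignited s"
    "r = promised_risk V (E - H) 0 (promise s)" "c = sum code H"
    using assms(1) unfolding candidates_def by blast
  have "promise s = of_bool (burns V (E - H) 0)"
    using H(3) assms(2) by (auto simp: promise_def ignited_def)
  then show ?thesis using H promised_risk_burns[of V "E - H" 0] by (auto simp: wfl_risk_eq)
qed

lemma runs_select_phase:
  assumes W: "fst \<sigma> ''W'' 0 = W" and tab: "tables \<sigma> (\<lambda>_. V) (\<lambda>_. E) {0}"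
  shows "runs Z select_phase \<sigma> (\<lambda>\<sigma>'. \<exists>H. optimal I H \<and> fst \<sigma>' ''msk'' 0 = sum code H)"
proof -
  define x where "x = fst \<sigma> ''cur'' 0 + W"
  define r where "r s = snd \<sigma> (tab s) x" for s
  define h where "h s = fst \<sigma> (tab s) x" for s
  have rep: "represents (candidates V E 0 s W) (r s) (h s)" if "s < 3" for s
    using tab that by (simp add: tables_def holds_def r_def h_def x_def)
  \<comment> \<open>\<open>1 - s\<close> is the competitor of \<open>s\<close> among the states 0
    and 1.\<close>
  have opt: "\<exists>H. optimal I H \<and> h s - 1 = sum code H"
    if s: "s < 2" "1 \<le> h s" and best: "1 \<le> h (1 - s) \<Longrightarrow> r s \<le> r (1 - s)" for s
  proof -
    have "(r s, h s - 1) \<in> candidates V E 0 s W" using rep[of s] s by (simp add: represents_def)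
    then obtain H where H: "H \<subseteq> E" "sum (cost I) H \<le> W" "r s = wfl_risk I H" "h s - 1 = sum code H"
      using final_candidatesD s by blast
    have "r s \<le> wfl_risk I H'" if H': "H' \<subseteq> E" "sum (cost I) H' \<le> W" for H'
    proof -
      obtain t where t: "t < 2" "(wfl_risk I H', sum code H') \<in> candidates V E 0 t W"
        using final_candidates[OF H'] by blast
      then have "1 \<le> h t" "r t \<le> wfl_risk I H'"
        using rep[of t] by (auto simp: represents_def split: if_splits)
      moreover have "t = s \<or> t = 1 - s" using s t by linarith
      ultimately show ?thesis using best by auto
    qed
    then have "optimal I H" using H unfolding optimal_def feasible_iff by simp
    then show ?thesis using H(4) by blast
  qed
  \<comment> \<open>The empty cut is always affordable, so at least one entry is genuine; this
    justifies the second branch, which decodes its entry without testing it.\<close>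
  have ex: "1 \<le> h 0 \<or> 1 \<le> h 1"
  proof -
    obtain t where "t < 2" "candidates V E 0 t W \<noteq> {}" using final_candidates[of "{}"] by auto
    then have "h t \<noteq> 0" using rep[of t] by (auto simp: represents_def)
    moreover have "t = 0 \<or> t = 1" using \<open>t < 2\<close> by linarith
    ultimately show ?thesis by auto
  qed
  let ?\<tau> = "(store ''x'' 0 x (fst \<sigma>), snd \<sigma>)"
  have "runs Z (Cond (BAnd (NLe one (NLoad (tab 0) (var ''x'')))
          (BNot (BAnd (NLe one (NLoad (tab 1) (var ''x'')))
             (RLe (RLoad (tab 1) (var ''x'')) (RLoad (tab 0) (var ''x''))))))
         (assign ''msk'' (NSub (NLoad (tab 0) (var ''x'')) one))
         (assign ''msk'' (NSub (NLoad (tab 1) (var ''x'')) one))) ?\<tau>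
      (\<lambda>\<sigma>'. \<exists>H. optimal I H \<and> fst \<sigma>' ''msk'' 0 = sum code H)"
  proof (rule runs_cond, goal_cases)
    case 1
    then have "1 \<le> h 0" "1 \<le> h 1 \<Longrightarrow> r 0 \<le> r 1" by (auto simp: store_apply h_def r_def)
    then show ?case using opt[of 0] by (intro runs_nstore) (simp add: store_apply h_def)
  next
    case 2
    then have "1 \<le> h 1" "1 \<le> h 0 \<Longrightarrow> r 1 \<le> r 0" using ex by (auto simp: store_apply h_def r_def)
    then show ?case using opt[of 1] by (intro runs_nstore) (simp add: store_apply h_def)
  qed
  then show ?thesis
    unfolding select_phase_def by (intro runs_seq runs_nstore) (simp add: x_def W)
qed

lemma runs_decode_phase:
  assumes inp: "input \<sigma>" and pw: "\<And>i. i \<le> m \<Longrightarrow> fst \<sigma> ''pw'' i = 2 ^ i"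
    and cut: "fst \<sigma> ''cut'' = (\<lambda>_. 0)" and msk: "fst \<sigma> ''msk'' 0 = sum code H" and H: "H \<subseteq> E"
  shows "runs Z decode_phase \<sigma> (\<lambda>\<sigma>'. cut_set es \<sigma>' = H)"
proof -
  define S where "S k = {i. i < k \<and> ed i \<in> H}" for k
  \<comment> \<open>Bits are taken from the top: \<open>msk\<close> keeps the undecided low bits,
    while \<open>cut\<close> is final from index \<open>m - k\<close> on.\<close>
  define J where "J k (\<tau> :: state) \<longleftrightarrow> fst \<tau> ''msk'' 0 = (\<Sum>i\<in>S (m - k). 2 ^ i) \<and>
    (\<forall>i. fst \<tau> ''cut'' i = of_bool (m - k \<le> i \<and> i < m \<and> ed i \<in> H))" for k \<tau>
  let ?c = "Seq (assign ''j'' (NSub (NSub (var ''m'') one) (var ''k'')))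
       (Cond (NLe (NLoad ''pw'' (var ''j'')) (var ''msk''))
         (Seq (NStore ''cut'' (var ''j'') one) (assign ''msk'' (NSub (var ''msk'') (NLoad ''pw'' (var ''j'')))))
         Skip)"
  show ?thesis
    unfolding decode_phase_def
  proof (rule runs_for_loop[where I = J and N = m])
    show "J 0 \<sigma>" using msk cut by (simp add: J_def S_def sum_code[OF H])
    show "J k (store ''k'' 0 v (fst s), snd s)" if "J k s" for k s v
      using that by (simp add: J_def store_apply)
  next
    fix \<tau> assume "J m \<tau>"
    then have "cut_set es \<tau> = ed ` {i. i < m \<and> ed i \<in> H}" by (auto simp: cut_set_def J_def ed_def)
    then show "cut_set es \<tau> = H" using image_ed[OF H] by simp
  next
    fix k \<tau> assume k: "k < m" and J: "J k \<tau>" and sm: "frame (for_loop ''k'' (var ''m'') ?c) \<sigma> \<tau>"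
      and kk: "fst \<tau> ''k'' 0 = k"
    define j where "j = m - 1 - k"
    have j: "m - k = Suc j" "m - Suc k = j" "j < m" using k by (auto simp: j_def)
    have "input \<tau>" by (rule input_frame[OF inp sm]) simp_all
    then have mm: "fst \<tau> ''m'' 0 = m" by (simp add: input_def)
    have p: "fst \<tau> ''pw'' j = 2 ^ j" using pw j by (simp add: frame_nat[OF sm])
    have msk: "fst \<tau> ''msk'' 0 = (\<Sum>i\<in>S (Suc j). 2 ^ i)"
      and cut: "\<And>i. fst \<tau> ''cut'' i = of_bool (Suc j \<le> i \<and> i < m \<and> ed i \<in> H)"
      using J unfolding J_def j by auto
    have iff: "2 ^ j \<le> (\<Sum>i\<in>S (Suc j). 2 ^ i :: nat) \<longleftrightarrow> ed j \<in> H"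
      using sum_powers_decode[of "S (Suc j)" j] by (auto simp: S_def)
    have S: "S (Suc j) = (if ed j \<in> H then insert j (S j) else S j)" "j \<notin> S j" "finite (S j)"
      by (auto simp: S_def less_Suc_eq)
    have ge: "j \<le> i \<longleftrightarrow> i = j \<or> Suc j \<le> i" for i by auto
    show "runs Z ?c \<tau> (J (Suc k))"
    proof (rule runs_seq, rule runs_nstore, rule runs_cond, goal_cases)
      case 1
      then have "ed j \<in> H" using iff by (simp add: store_apply kk mm p msk flip: j_def[simplified])
      then show ?case
        using j(3) by (intro runs_seq runs_nstore)
          (simp add: store_apply kk mm p msk S J_def j(2) cut ge flip: j_def[simplified])
    next
      case 2
      then have "ed j \<notin> H" using iff by (simp add: store_apply kk mm p msk flip: j_def[simplified])
      then show ?case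
        by (intro runs_skip) (auto simp add: store_apply msk S J_def j(2) cut ge)
    qed
  qed (use inp in \<open>simp_all add: Z_def input_def frame_nat\<close>)
qed

lemma runs_program: "runs Z program (encode I es) (\<lambda>\<sigma>. optimal I (cut_set es \<sigma>))"
proof -
  let ?s = "encode I es"
  have s: "input ?s"
    by (auto simp: input_def encode_def array_of_def ed_def case_prod_beta)
  have zero: "fst ?s a = (\<lambda>_. 0)" if "a \<notin> {''n'', ''m'', ''src'', ''dst'', ''cost''}" for a
    using that by (simp add: encode_def)
  have rzero: "snd ?s a = (\<lambda>_. 0)" if "a \<notin> {''value'', ''ignition'', ''budget''}" for a
    using that by (simp add: encode_def)
  \<comment> \<open>With the phases unfolded, simplification decides from their syntax which arrays
    keep their values.\<close>
  note phases = budget_phase_def power_phase_def init_phase_def init_entry_def order_phase_def search_def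
    merge_phase_def merge_table_def select_phase_def Let_def
  show ?thesis
    unfolding program_def
  proof (rule runs_seq_frame[OF runs_budget_phase])
    fix s1 assume 1: "fst s1 ''W'' 0 = W \<and> fst s1 ''W1'' 0 = Suc W" and sm1: "frame budget_phase ?s s1"
    note e1 = frame_nat[OF sm1, simplified phases]
    have i1: "input s1" by (rule input_frame[OF s sm1]) (simp_all add: phases)
    show "runs Z (Seq power_phase (Seq init_phase (Seq order_phase (Seq merge_phase
       (Seq select_phase decode_phase))))) s1 (\<lambda>\<sigma>. optimal I (cut_set es \<sigma>))"
    proof (rule runs_seq_frame[OF runs_power_phase[OF i1]])
      fix s2 assume 2: "\<forall>i\<le>m. fst s2 ''pw'' i = 2 ^ i" and sm2: "frame power_phase s1 s2"
      note e2 = frame_nat[OF sm2, simplified phases]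
      have i2: "input s2" by (rule input_frame[OF i1 sm2]) (simp_all add: phases)
      have c2: "clean s2" "fst s2 ''W1'' 0 = Suc W" using 1 by (simp_all add: clean_def e2 e1 zero)
      show "runs Z (Seq init_phase (Seq order_phase (Seq merge_phase (Seq select_phase decode_phase)))) s2
          (\<lambda>\<sigma>. optimal I (cut_set es \<sigma>))"
      proof (rule runs_seq_frame[OF runs_init_phase[OF i2 c2(2,1)]])
        fix s3 assume 3: "tables s3 (\<lambda>v. {v}) (\<lambda>_. {}) {..<n} \<and> clean s3" and sm3: "frame init_phase s2 s3"
        note e3 = frame_nat[OF sm3, simplified phases]
        have i3: "input s3" by (rule input_frame[OF i2 sm3]) (simp_all add: phases)
        have v3: "fst s3 ''vis'' = (\<lambda>_. 0)" by (simp add: e3 e2 e1 zero)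
        show "runs Z (Seq order_phase (Seq merge_phase (Seq select_phase decode_phase))) s3
          (\<lambda>\<sigma>. optimal I (cut_set es \<sigma>))"
        proof (rule runs_seq_frame[OF runs_order_phase[OF i3 v3]])
          fix s4 assume 4: "fst s4 ''N'' 0 = n - 1 \<and>
            growing (fst s4 ''par'') (fst s4 ''chi'') (fst s4 ''eid'') (n - 1)"
            and sm4: "frame order_phase s3 s4"
          note e4 = frame_nat[OF sm4, simplified phases] and r4 = frame_real[OF sm4, simplified phases]
          have i4: "input s4" by (rule input_frame[OF i3 sm4]) (simp_all add: phases)
          have t4: "tables s4 (\<lambda>v. {v}) (\<lambda>_. {}) {..<n}" "clean s4"
            using 3 by (simp_all add: tables_def clean_def holds_def e4 r4)
          have "runs Z merge_phase s4 (\<lambda>\<sigma>'. tables \<sigma>' (\<lambda>_. V) (\<lambda>_. E) {0})"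
            by (rule runs_merge_phase[OF i4]) (use 4 1 2 t4 in \<open>simp_all add: e4 e3 e2\<close>)
          then show "runs Z (Seq merge_phase (Seq select_phase decode_phase)) s4
            (\<lambda>\<sigma>. optimal I (cut_set es \<sigma>))"
          proof (rule runs_seq_frame)
            fix s5 assume t5: "tables s5 (\<lambda>_. V) (\<lambda>_. E) {0}" and sm5: "frame merge_phase s4 s5"
            note e5 = frame_nat[OF sm5, simplified phases]
            have i5: "input s5" by (rule input_frame[OF i4 sm5]) (simp_all add: phases)
            have "fst s5 ''W'' 0 = W" using 1 by (simp add: e5 e4 e3 e2)
            from runs_select_phase[OF this t5]
            show "runs Z (Seq select_phase decode_phase) s5 (\<lambda>\<sigma>. optimal I (cut_set es \<sigma>))"
            proof (rule runs_seq_frame)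
              fix s6 assume "\<exists>H. optimal I H \<and> fst s6 ''msk'' 0 = sum code H" and sm6: "frame select_phase s5 s6"
              then obtain H where H: "optimal I H" "fst s6 ''msk'' 0 = sum code H" by blast
              note e6 = frame_nat[OF sm6, simplified phases]
              have i6: "input s6" by (rule input_frame[OF i5 sm6]) (simp_all add: phases)
              have "runs Z decode_phase s6 (\<lambda>\<sigma>'. cut_set es \<sigma>' = H)"
              proof (rule runs_decode_phase[OF i6 _ _ H(2)])
                show "fst s6 ''pw'' i = 2 ^ i" if "i \<le> m" for i
                  using 2 that by (simp add: e6 e5 e4 e3)
                show "fst s6 ''cut'' = (\<lambda>_. 0)" by (simp add: e6 e5 e4 e3 e2 e1 zero)
                show "H \<subseteq> E" using H(1) by (simp add: optimal_def feasible_def)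
              qed
              then show "runs Z decode_phase s6 (\<lambda>\<sigma>. optimal I (cut_set es \<sigma>))"
                by (rule runs_conseq) (use H(1) in simp)
            qed
          qed
        qed
      qed
    qed
  qed (use s in \<open>simp_all add: zero rzero\<close>)
qed

section \<open>Polynomial bounds on the number of rounds\<close>

lemma m_le: "m \<le> n ^ 2"
proof -
  have "E \<subseteq> (\<lambda>(u, v). {u, v}) ` (V \<times> V)"
  proof
    fix e assume e: "e \<in> E"
    then obtain u v where "e = {u, v}" by (meson edgeD(2) card_2_iff)
    then show "e \<in> (\<lambda>(u, v). {u, v}) ` (V \<times> V)" using edgeD(1)[OF e] by auto
  qed
  then have "card E \<le> card (V \<times> V)" by (rule surj_card_le[rotated]) simp
  moreover have "card E = m" using bij_betw_same_card[OF ed_bij] by simp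
  ultimately show ?thesis by (simp add: power2_eq_square)
qed

text \<open>A bound \<open>b\<close> on the budget gives \<open>W\<close> at most \<open>b\<close>,
  one on the costs at most \<open>m * b\<close>; the factor \<open>n ^ 2 + 1\<close> covers both
  cases.\<close>

lemma W_le:
  assumes "budget I \<le> b \<or> (\<forall>e\<in>E. real (cost I e) \<le> b)" "0 \<le> b"
  shows "real W \<le> (real n ^ 2 + 1) * b"
proof -
  have "real W \<le> b \<or> real W \<le> real m * b"
    using assms(1)
  proof
    assume "budget I \<le> b"
    moreover have "real W \<le> budget I" 
    proof -
      have "real W \<le> real (nat \<lfloor>budget I\<rfloor>)" by (simp add: W_def)
      also have "\<dots> \<le> budget I" using tree_facts(3) by simp
      finally show ?thesis .
    qed
    ultimately show ?thesis by simp
  next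
    assume b: "\<forall>e\<in>E. real (cost I e) \<le> b"
    have "real W \<le> (\<Sum>e\<in>E. real (cost I e))" by (simp add: W_def flip: of_nat_sum)
    also have "\<dots> \<le> real (card E) * b" using b by (intro sum_bounded_above) auto
    also have "card E = m" using bij_betw_same_card[OF ed_bij] by simp
    finally show ?thesis by simp
  qed
  moreover have "real m * b \<le> real n ^ 2 * b" using m_le assms(2)
    by (intro mult_right_mono) (simp_all flip: of_nat_power)
  moreover have "0 \<le> real n ^ 2 * b" using assms(2) by simp
  ultimately show ?thesis using assms(2) unfolding distrib_right by linarith
qed

text \<open>In units of the top power, \<open>W\<close> contributes at most \<open>2 * c\<close>,
  \<open>n\<close> and \<open>m\<close> one each, and the constant 2 two more. The exponent
  \<open>k + 2\<close> comes from the quadratic bound on the number of edges.\<close>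

lemma Z_le:
  assumes "budget I \<le> real c * real n ^ k \<or> (\<forall>e\<in>E. real (cost I e) \<le> real c * real n ^ k)"
  shows "real Z \<le> real (2 * c + 4) * real n ^ (k + 2)"
proof -
  have 1: "1 \<le> real n" using n_pos by simp
  have p: "real n ^ i \<le> real n ^ (k + 2)" if "i \<le> k + 2" for i using that 1 by (rule power_increasing)
  have "real W \<le> (real n ^ 2 + 1) * (real c * real n ^ k)" using W_le[OF assms] by simp
  also have "\<dots> = real c * real n ^ (k + 2) + real c * real n ^ k" by (simp add: power_add power2_eq_square algebra_simps)
  also have "\<dots> \<le> real c * real n ^ (k + 2) + real c * real n ^ (k + 2)"
    using p[of k] by (intro add_left_mono mult_left_mono) auto
  finally have W: "real W \<le> 2 * (real c * real n ^ (k + 2))" by simp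
  have "real m \<le> real n ^ (k + 2)"
    using m_le p[of 2] by (metis le_add2 of_nat_le_iff of_nat_power order_trans)
  moreover have "real n \<le> real n ^ (k + 2)" "1 \<le> real n ^ (k + 2)" using p[of 1] p[of 0] by auto
  ultimately have "real n + real m + real W + 2 \<le> 2 * (real c * real n ^ (k + 2)) + 4 * real n ^ (k + 2)"
    using W by linarith
  then show ?thesis by (simp add: Z_def algebra_simps)
qed

end

theorem theorem3:
  shows "\<exists>P. solves_wfl_tree P \<and>
    (\<forall>F. (\<forall>I\<in>F. wfl_tree I) \<longrightarrow>
       poly_bounded (budgets F) \<or> poly_bounded (edge_costs F) \<longrightarrow>
       poly_bounded (running_times P F))"
proof (intro exI conjI allI impI)
  show "solves_wfl_tree program"
    unfolding solves_wfl_tree_def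
  proof (intro allI impI)
    fix I es assume "wfl_tree I" "edge_listing I es"
    then interpret listed_tree I es by unfold_locales
    show "\<exists>t s. exec program (encode I es) t s \<and> optimal I (cut_set es s)"
      using runs_program unfolding runs_def by blast
  qed
  fix F assume F: "\<forall>I\<in>F. wfl_tree I" and poly: "poly_bounded (budgets F) \<or> poly_bounded (edge_costs F)"
  \<comment> \<open>\<open>a\<close> and \<open>d\<close> depend only on the program and are thus
    uniform over the family.\<close>
  obtain a d where ad: "\<And>Z. Z \<ge> 1 \<Longrightarrow> time_bound Z program \<le> a * Z ^ d" using time_bound_polynomial by blast
  \<comment> \<open>The disjunction is pushed inside the quantifier over instances, so that both
    hypotheses are used through one common pair \<open>c\<close>, \<open>k\<close>.\<close>
  have "\<exists>c k. \<forall>I\<in>F. budget I \<le> real c * real (nverts I) ^ k \<or>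
      (\<forall>e\<in>edges I. real (cost I e) \<le> real c * real (nverts I) ^ k)"
    using poly unfolding poly_bounded_def budgets_def edge_costs_def by fast
  then obtain c k where ck: "\<And>I. I \<in> F \<Longrightarrow> budget I \<le> real c * real (nverts I) ^ k \<or>
      (\<forall>e\<in>edges I. real (cost I e) \<le> real c * real (nverts I) ^ k)" by blast
  have "real t \<le> real (a * (2 * c + 4) ^ d) * real (nverts I) ^ ((k + 2) * d)"
    if "I \<in> F" "edge_listing I es" "exec program (encode I es) t s" for I es t s
  proof -
    interpret listed_tree I es using F that by unfold_locales auto
    obtain t' s' where "exec program (encode I es) t' s'" "t' \<le> time_bound Z program"
      using runs_program unfolding runs_def by blast
    \<comment> \<open>Determinism transfers the bound from the run constructed for correctness to
      the given one.\<close>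
    then have "t \<le> time_bound Z program" using exec_deterministic that(3) by blast
    also have "\<dots> \<le> a * Z ^ d" by (rule ad) (simp add: Z_def)
    finally have "real t \<le> real a * real Z ^ d" by (simp flip: of_nat_power of_nat_mult)
    also have "\<dots> \<le> real a * (real (2 * c + 4) * real n ^ (k + 2)) ^ d"
      using Z_le[OF ck[OF that(1)]] by (intro mult_left_mono power_mono) auto
    also have "\<dots> = real (a * (2 * c + 4) ^ d) * real n ^ ((k + 2) * d)"
      unfolding power_mult_distrib power_mult by simp
    finally show ?thesis .
  qed
  then show "poly_bounded (running_times program F)"
    unfolding poly_bounded_def running_times_def by fast
qed

end
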